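(* Let $R$ be a graded local ring, and let $D$ be a differential $R$-module whose differential is homogeneous of degree $0$ and such that its homology $H(D)$ is finitely generated. Let $$F_0\xleftarrow{\ \partial_{1,0}\ }F_1\xleftarrow{\ \partial_{2,1}\ }F_2\xleftarrow{\ \partial_{3,2}\ }\cdots$$ be a minimal free resolution of the $R$-module $H(D)$. Then there exists a free flag resolution of $D$ whose underlying module is $\bigoplus_i F_i$ and whose differential $\partial$ has the following strictly upper triangular block form: the component of $\partial$ from $F_i$ to $F_j$ is $0$ if $j\ge i$, it is the given map $\partial_{i,i-1}$ if $j=i-1$, and it is some homogeneous $R$-linear map $\partial_{i,j}\colon F_i\to F_j$ if $j<i-1$.
   Context: A graded local ring is an $\mathbb{N}$-graded Noetherian (not necessarily commutative) ring $R=\bigoplus_{i\ge 0}R_i$ with $R_0$ a (not necessarily commutative) local ring; $\mathfrak{m}$ denotes its maximal ideal, the sum of the maximal ideal of $R_0$ and $R_+=\bigoplus_{i>0}R_i$. All modules are graded left $R$-modules and all maps are graded (homogeneous). A differential $R$-module of degree $0$ is a pair $(D,\partial)$ with $D$ an $R$-module and $\partial\colon D\to D$ a degree-preserving $R$-linear map with $\partial^2=0$. A morphism is a degree-preserving $R$-linear map commuting with the differentials. The homology is $H(D)=\ker\partial/\operatorname{im}\partial$, and a quasi-isomorphism is a morphism inducing an isomorphism on homology. A free flag is a differential module of the form $F=\bigoplus_{i\ge 0}F_i$ where each $F_i$ is a free $R$-module and $\partial_F(F_i)\subseteq\bigoplus_{j<i}F_j$ for all $i$. A free flag resolution of $D$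 is a quasi-isomorphism $F\to D$ with $F$ a free flag. The minimal free resolution of the (ordinary) module $H(D)$ is the usual one: a free resolution by finitely generated graded free modules, with $\partial_{i,i-1}(F_i)\subseteq\mathfrak{m}F_{i-1}$. *)

theory Defs
  imports "HOL-Algebra.Module" "HOL-Algebra.AbelCoset" "HOL-Algebra.Generated_Groups"
begin

section \<open>Left modules over a ring that need not be commutative\<close>

text \<open>The locale \<^locale>\<open>module\<close> of the library requires a commutative base ring. Its record
  and its locale \<^locale>\<open>submodule\<close> make sense over any ring and are reused here.\<close>

locale left_module = R?: ring R + M?: abelian_group M
  for R :: "('a, 'r) ring_scheme" (structure) and M :: "('a, 'b, 'm) module_scheme" (structure) +
  assumes smult_closed [simp, intro]:
      "\<lbrakk>a \<in> carrier R; x \<in> carrier M\<rbrakk> \<Longrightarrow> a \<odot>\<^bsub>M\<^esub> x \<in> carrier M"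
    and smult_l_distr:
      "\<lbrakk>a \<in> carrier R; b \<in> carrier R; x \<in> carrier M\<rbrakk> \<Longrightarrow>
        (a \<oplus>\<^bsub>R\<^esub> b) \<odot>\<^bsub>M\<^esub> x = a \<odot>\<^bsub>M\<^esub> x \<oplus>\<^bsub>M\<^esub> b \<odot>\<^bsub>M\<^esub> x"
    and smult_r_distr:
      "\<lbrakk>a \<in> carrier R; x \<in> carrier M; y \<in> carrier M\<rbrakk> \<Longrightarrow>
        a \<odot>\<^bsub>M\<^esub> (x \<oplus>\<^bsub>M\<^esub> y) = a \<odot>\<^bsub>M\<^esub> x \<oplus>\<^bsub>M\<^esub> a \<odot>\<^bsub>M\<^esub> y"
    and smult_assoc1:
      "\<lbrakk>a \<in> carrier R; b \<in> carrier R; x \<in> carrier M\<rbrakk> \<Longrightarrow>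
        (a \<otimes>\<^bsub>R\<^esub> b) \<odot>\<^bsub>M\<^esub> x = a \<odot>\<^bsub>M\<^esub> (b \<odot>\<^bsub>M\<^esub> x)"
    and smult_one [simp]: "x \<in> carrier M \<Longrightarrow> \<one>\<^bsub>R\<^esub> \<odot>\<^bsub>M\<^esub> x = x"

definition submodule_span ::
    "('a, 'r) ring_scheme \<Rightarrow> ('a, 'b, 'm) module_scheme \<Rightarrow> 'b set \<Rightarrow> 'b set" where
  "submodule_span R M A = \<Inter>{N. submodule N R M \<and> A \<subseteq> N}"

definition finitely_generated :: "('a, 'r) ring_scheme \<Rightarrow> ('a, 'b, 'm) module_scheme \<Rightarrow> bool" where
  "finitely_generated R M \<longleftrightarrow>
     (\<exists>A. finite A \<and> A \<subseteq> carrier M \<and> carrier M = submodule_span R M A)"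

definition regular_module :: "('a, 'r) ring_scheme \<Rightarrow> ('a, 'a) module" where
  "regular_module R =
     \<lparr>carrier = carrier R, mult = mult R, one = one R, zero = zero R, add = add R,
      smult = mult R\<rparr>"

definition left_ideal :: "'a set \<Rightarrow> ('a, 'r) ring_scheme \<Rightarrow> bool" where
  "left_ideal I R \<longleftrightarrow> submodule I R (regular_module R)"

text \<open>All modules are left modules, so only left ideals are constrained.\<close>

definition left_noetherian :: "('a, 'r) ring_scheme \<Rightarrow> bool" where
  "left_noetherian R \<longleftrightarrow>
     (\<forall>I. left_ideal I R \<longrightarrow>
        (\<exists>A. finite A \<and> A \<subseteq> carrier R \<and> I = submodule_span R (regular_module R) A))"

definition maximal_left_ideal :: "'a set \<Rightarrow> ('a, 'r) ring_scheme \<Rightarrow> bool" where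
  "maximal_left_ideal I R \<longleftrightarrow>
     left_ideal I R \<and> I \<noteq> carrier R \<and>
     (\<forall>J. left_ideal J R \<and> I \<subseteq> J \<longrightarrow> J = I \<or> J = carrier R)"

text \<open>In a local ring the unique maximal left ideal is two-sided: it is the Jacobson radical.\<close>

definition local_ring :: "('a, 'r) ring_scheme \<Rightarrow> bool" where
  "local_ring R \<longleftrightarrow> ring R \<and> (\<exists>!I. maximal_left_ideal I R)"

section \<open>Gradings\<close>

definition internal_direct_sum :: "('b, 'm) ring_scheme \<Rightarrow> ('i \<Rightarrow> 'b set) \<Rightarrow> bool" where
  "internal_direct_sum M A \<longleftrightarrow>
     (\<forall>i. subgroup (A i) (add_monoid M)) \<and>
     (\<forall>x \<in> carrier M. \<exists>!f. (\<forall>i. f i \<in> A i) \<and> finite {i. f i \<noteq> \<zero>\<^bsub>M\<^esub>} \<and>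
        x = (\<Oplus>\<^bsub>M\<^esub>i \<in> {i. f i \<noteq> \<zero>\<^bsub>M\<^esub>}. f i))"

record 'a gring = "'a ring" +
  rcomp :: "nat \<Rightarrow> 'a set"

text \<open>Modules are graded by the integers, so that twists in both directions are available.\<close>

record ('a, 'b) gmodule = "('a, 'b) module" +
  mcomp :: "int \<Rightarrow> 'b set"

locale graded_ring = ring R for R :: "'a gring" (structure) +
  assumes rcomp_direct_sum: "internal_direct_sum R (rcomp R)"
    and one_rcomp: "\<one> \<in> rcomp R 0"
    and mult_rcomp: "\<lbrakk>a \<in> rcomp R i; b \<in> rcomp R j\<rbrakk> \<Longrightarrow> a \<otimes> b \<in> rcomp R (i + j)"

locale graded_module = graded_ring R + left_module R M
  for R :: "'a gring" (structure) and M :: "('a, 'b) gmodule" (structure) +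
  assumes mcomp_direct_sum: "internal_direct_sum M (mcomp M)"
    and smult_mcomp:
      "\<lbrakk>a \<in> rcomp R i; x \<in> mcomp M n\<rbrakk> \<Longrightarrow> a \<odot>\<^bsub>M\<^esub> x \<in> mcomp M (int i + n)"

definition degree_zero_ring :: "'a gring \<Rightarrow> 'a gring" where
  "degree_zero_ring R = R\<lparr>carrier := rcomp R 0\<rparr>"

definition graded_local_ring :: "'a gring \<Rightarrow> bool" where
  "graded_local_ring R \<longleftrightarrow>
     graded_ring R \<and> left_noetherian R \<and> local_ring (degree_zero_ring R)"

definition irrelevant_ideal :: "'a gring \<Rightarrow> 'a set" where
  "irrelevant_ideal R = generate (add_monoid R) (\<Union>i\<in>{0<..}. rcomp R i)"

definition graded_maximal_ideal :: "'a gring \<Rightarrow> 'a set" where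
  "graded_maximal_ideal R =
     (THE I. maximal_left_ideal I (degree_zero_ring R)) <+>\<^bsub>R\<^esub> irrelevant_ideal R"

definition ideal_smult :: "'a set \<Rightarrow> ('a, 'b) gmodule \<Rightarrow> 'b set" where
  "ideal_smult I M = generate (add_monoid M) {a \<odot>\<^bsub>M\<^esub> x | a x. a \<in> I \<and> x \<in> carrier M}"

definition graded_hom :: "'a gring \<Rightarrow> ('a, 'b) gmodule \<Rightarrow> ('a, 'c) gmodule \<Rightarrow> ('b \<Rightarrow> 'c) set" where
  "graded_hom R M N =
     {f \<in> hom (add_monoid M) (add_monoid N).
        (\<forall>a \<in> carrier R. \<forall>x \<in> carrier M. f (a \<odot>\<^bsub>M\<^esub> x) = a \<odot>\<^bsub>N\<^esub> f x) \<and>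
        (\<forall>n. f ` mcomp M n \<subseteq> mcomp N n)}"

definition homogeneous_basis :: "'a gring \<Rightarrow> ('a, 'b) gmodule \<Rightarrow> 'b set \<Rightarrow> bool" where
  "homogeneous_basis R M B \<longleftrightarrow>
     B \<subseteq> (\<Union>n. mcomp M n) \<and>
     (\<forall>x \<in> carrier M. \<exists>!c. c \<in> B \<rightarrow>\<^sub>E carrier R \<and> finite {b \<in> B. c b \<noteq> \<zero>\<^bsub>R\<^esub>} \<and>
        x = (\<Oplus>\<^bsub>M\<^esub>b \<in> {b \<in> B. c b \<noteq> \<zero>\<^bsub>R\<^esub>}. c b \<odot>\<^bsub>M\<^esub> b))"

definition graded_free :: "'a gring \<Rightarrow> ('a, 'b) gmodule \<Rightarrow> bool" where
  "graded_free R M \<longleftrightarrow> graded_module R M \<and> (\<exists>B. homogeneous_basis R M B)"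

section \<open>Differential modules of degree zero and their homology\<close>

definition differential_module :: "'a gring \<Rightarrow> ('a, 'b) gmodule \<Rightarrow> ('b \<Rightarrow> 'b) \<Rightarrow> bool" where
  "differential_module R D \<delta> \<longleftrightarrow>
     graded_module R D \<and> \<delta> \<in> graded_hom R D D \<and> (\<forall>x \<in> carrier D. \<delta> (\<delta> x) = \<zero>\<^bsub>D\<^esub>)"

text \<open>The fields \<^const>\<open>mult\<close> and \<^const>\<open>one\<close> that a module record inherits from rings play no role
  for modules.\<close>

definition quotient_gmodule :: "('a, 'b) gmodule \<Rightarrow> 'b set \<Rightarrow> ('a, 'b set) gmodule" where
  "quotient_gmodule M N =
     \<lparr>carrier = a_rcosets\<^bsub>M\<^esub> N, mult = undefined, one = undefined,
      zero = N, add = set_add M,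
      smult = (\<lambda>a X. \<Union>x\<in>X. N +>\<^bsub>M\<^esub> (a \<odot>\<^bsub>M\<^esub> x)),
      mcomp = (\<lambda>n. {N +>\<^bsub>M\<^esub> x | x. x \<in> mcomp M n})\<rparr>"

definition cycles :: "('a, 'b) gmodule \<Rightarrow> ('b \<Rightarrow> 'b) \<Rightarrow> ('a, 'b) gmodule" where
  "cycles D \<delta> =
     D\<lparr>carrier := a_kernel D D \<delta>, mcomp := (\<lambda>n. mcomp D n \<inter> a_kernel D D \<delta>)\<rparr>"

definition homology :: "('a, 'b) gmodule \<Rightarrow> ('b \<Rightarrow> 'b) \<Rightarrow> ('a, 'b set) gmodule" where
  "homology D \<delta> = quotient_gmodule (cycles D \<delta>) (\<delta> ` carrier D)"

text \<open>For a morphism f the union below is over one and the same coset.\<close>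

definition homology_map :: "('a, 'c) gmodule \<Rightarrow> ('c \<Rightarrow> 'c) \<Rightarrow> ('b \<Rightarrow> 'c) \<Rightarrow> 'b set \<Rightarrow> 'c set" where
  "homology_map D' \<delta>' f = (\<lambda>X. \<Union>x\<in>X. (\<delta>' ` carrier D') +>\<^bsub>D'\<^esub> f x)"

definition differential_morphism ::
    "'a gring \<Rightarrow> ('a, 'b) gmodule \<Rightarrow> ('b \<Rightarrow> 'b) \<Rightarrow> ('a, 'c) gmodule \<Rightarrow> ('c \<Rightarrow> 'c) \<Rightarrow> ('b \<Rightarrow> 'c) \<Rightarrow> bool"
  where
  "differential_morphism R D \<delta> D' \<delta>' f \<longleftrightarrow>
     f \<in> graded_hom R D D' \<and> (\<forall>x \<in> carrier D. f (\<delta> x) = \<delta>' (f x))"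

definition quasi_isomorphism ::
    "'a gring \<Rightarrow> ('a, 'b) gmodule \<Rightarrow> ('b \<Rightarrow> 'b) \<Rightarrow> ('a, 'c) gmodule \<Rightarrow> ('c \<Rightarrow> 'c) \<Rightarrow> ('b \<Rightarrow> 'c) \<Rightarrow> bool"
  where
  "quasi_isomorphism R D \<delta> D' \<delta>' f \<longleftrightarrow>
     differential_morphism R D \<delta> D' \<delta>' f \<and>
     homology_map D' \<delta>' f \<in> graded_hom R (homology D \<delta>) (homology D' \<delta>') \<and>
     bij_betw (homology_map D' \<delta>' f) (carrier (homology D \<delta>)) (carrier (homology D' \<delta>'))"

section \<open>Free flags and minimal free resolutions\<close>

definition direct_sum :: "(nat \<Rightarrow> ('a, 'b) gmodule) \<Rightarrow> ('a, nat \<Rightarrow> 'b) gmodule" where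
  "direct_sum F =
     (let S = {x. (\<forall>i. x i \<in> carrier (F i)) \<and> finite {i. x i \<noteq> \<zero>\<^bsub>F i\<^esub>}} in
      \<lparr>carrier = S, mult = undefined, one = undefined,
       zero = (\<lambda>i. \<zero>\<^bsub>F i\<^esub>), add = (\<lambda>x y i. x i \<oplus>\<^bsub>F i\<^esub> y i),
       smult = (\<lambda>a x i. a \<odot>\<^bsub>F i\<^esub> x i),
       mcomp = (\<lambda>n. {x \<in> S. \<forall>i. x i \<in> mcomp (F i) n})\<rparr>)"

definition summand_incl :: "(nat \<Rightarrow> ('a, 'b) gmodule) \<Rightarrow> nat \<Rightarrow> 'b \<Rightarrow> nat \<Rightarrow> 'b" where
  "summand_incl F i x = (\<lambda>j. if j = i then x else \<zero>\<^bsub>F j\<^esub>)"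

text \<open>The component from summand i to summand j of an endomap of the direct sum.\<close>

definition block ::
    "(nat \<Rightarrow> ('a, 'b) gmodule) \<Rightarrow> ((nat \<Rightarrow> 'b) \<Rightarrow> (nat \<Rightarrow> 'b)) \<Rightarrow> nat \<Rightarrow> nat \<Rightarrow> 'b \<Rightarrow> 'b" where
  "block F \<Delta> i j = (\<lambda>x. \<Delta> (summand_incl F i x) j)"

definition free_flag ::
    "'a gring \<Rightarrow> (nat \<Rightarrow> ('a, 'b) gmodule) \<Rightarrow> ((nat \<Rightarrow> 'b) \<Rightarrow> (nat \<Rightarrow> 'b)) \<Rightarrow> bool" where
  "free_flag R F \<Delta> \<longleftrightarrow>
     differential_module R (direct_sum F) \<Delta> \<and>
     (\<forall>i. graded_free R (F i)) \<and>
     (\<forall>i. \<forall>x \<in> carrier (F i).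
        \<Delta> (summand_incl F i x) \<in> {y \<in> carrier (direct_sum F). \<forall>j\<ge>i. y j = \<zero>\<^bsub>F j\<^esub>})"

definition free_flag_resolution ::
    "'a gring \<Rightarrow> (nat \<Rightarrow> ('a, 'b) gmodule) \<Rightarrow> ((nat \<Rightarrow> 'b) \<Rightarrow> (nat \<Rightarrow> 'b)) \<Rightarrow>
      ('a, 'c) gmodule \<Rightarrow> ('c \<Rightarrow> 'c) \<Rightarrow> ((nat \<Rightarrow> 'b) \<Rightarrow> 'c) \<Rightarrow> bool" where
  "free_flag_resolution R F \<Delta> D \<delta> \<epsilon> \<longleftrightarrow>
     free_flag R F \<Delta> \<and> quasi_isomorphism R (direct_sum F) \<Delta> D \<delta> \<epsilon>"

text \<open>The map d i goes from F (i + 1) to F i, and e is the augmentation from F 0 to M.\<close>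

definition minimal_free_resolution ::
    "'a gring \<Rightarrow> (nat \<Rightarrow> ('a, 'b) gmodule) \<Rightarrow> (nat \<Rightarrow> 'b \<Rightarrow> 'b) \<Rightarrow> ('b \<Rightarrow> 'c) \<Rightarrow>
      ('a, 'c) gmodule \<Rightarrow> bool" where
  "minimal_free_resolution R F d e M \<longleftrightarrow>
     (\<forall>i. graded_free R (F i) \<and> finitely_generated R (F i)) \<and>
     (\<forall>i. d i \<in> graded_hom R (F (Suc i)) (F i)) \<and>
     e \<in> graded_hom R (F 0) M \<and>
     e ` carrier (F 0) = carrier M \<and>
     a_kernel (F 0) M e = d 0 ` carrier (F 1) \<and>
     (\<forall>i. a_kernel (F (Suc i)) (F i) (d i) = d (Suc i) ` carrier (F (Suc (Suc i)))) \<and>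
     (\<forall>i. d i ` carrier (F (Suc i)) \<subseteq> ideal_smult (graded_maximal_ideal R) (F i))"

end

theory Submission
  imports Defs
begin

text \<open>
  The differential \<open>\<Delta>\<close> on the direct sum of the \<open>F i\<close> and the map \<open>\<epsilon>\<close> to D are constructed together,
  one summand at a time. On \<open>F 0\<close> the differential vanishes and \<open>\<epsilon>\<close> lifts the augmentation e to cycles
  of D, which is possible as \<open>F 0\<close> is free.

  Suppose that \<open>\<Delta>\<close> and \<open>\<epsilon>\<close> exist on \<open>F 0, \<dots>, F p\<close>. For x in \<open>F (p + 1)\<close> the element \<open>d p x\<close> is a cycle of
  the resolution, but in general not of the flag, because \<open>\<Delta>\<close> has further components,
  from \<open>F p\<close> to \<open>F j\<close> with \<open>j < p - 1\<close>. It can be corrected in lower summands to a cycle z of the flag whose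
  image \<open>\<epsilon> z\<close> is a boundary in D (\<open>flag_lift_cycle\<close>). Then \<open>\<Delta> x = z\<close> and \<open>\<epsilon> x = w\<close> with
  \<open>\<delta> w = \<epsilon> z\<close> continue the construction. The corrections are possible because of \<open>flag_exact\<close>: a cycle of
  the flag which maps to a boundary in D is a boundary, by exactness of the resolution, and it is
  killed by the very next summand. The choices can be made linearly and in the right degree since
  \<open>F (p + 1)\<close> is graded free; \<open>graded_free_lift\<close> expresses this for an arbitrary relation between
  arguments and values.

  In the limit, \<open>\<epsilon>\<close> is a quasi-isomorphism. It is surjective on homology already on \<open>F 0\<close>, because e is
  surjective, and it is injective on homology by \<open>flag_exact\<close>. The entry of z in \<open>F p\<close> is \<open>d p x\<close>, as the
  corrections are made in lower summands, so the entries of \<open>\<Delta>\<close> next to the diagonal are the maps d.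
\<close>

section \<open>Additive maps\<close>

lemma abelian_group_hom_of_hom:
  assumes "abelian_group M" "abelian_group N" "f \<in> hom (add_monoid M) (add_monoid N)"
  shows "abelian_group_hom M N f"
  using assms by (intro abelian_group_homI group_hom.intro group_hom_axioms.intro)
    (simp_all add: abelian_group.a_group)

lemma (in abelian_group_hom) hom_finsum:
  assumes "g \<in> A \<rightarrow> carrier G"
  shows "h (finsum G g A) = finsum H (\<lambda>i. h (g i)) A"
  using assms
proof (induction A rule: infinite_finite_induct)
  case (insert a A)
  have "g \<in> A \<rightarrow> carrier G" "(\<lambda>i. h (g i)) \<in> A \<rightarrow> carrier H" "g a \<in> carrier G"
    using insert.prems by (auto simp: Pi_iff)
  then show ?case
    using insert by (simp add: G.finsum_insert H.finsum_insert)
qed (simp_all add: finsum_def finprod_def)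

lemma (in abelian_group_hom) hom_minus:
  "\<lbrakk>x \<in> carrier G; y \<in> carrier G\<rbrakk> \<Longrightarrow> h (x \<ominus>\<^bsub>G\<^esub> y) = h x \<ominus>\<^bsub>H\<^esub> h y"
  by (simp add: a_minus_def)

lemma (in abelian_group) uminus_zero [simp]: "\<ominus> \<zero> = \<zero>"
  by (rule minus_equality) simp_all

lemma (in abelian_group) finsum_support:
  assumes "finite S" "{i. f i \<noteq> \<zero>} \<subseteq> S" "\<And>i. f i \<in> carrier G"
  shows "finsum G f {i. f i \<noteq> \<zero>} = finsum G f S"
  by (rule add.finprod_mono_neutral_cong_left) (use assms in auto)

lemma (in abelian_group) subgroup_finsum_closed:
  assumes "subgroup H (add_monoid G)" "\<And>i. i \<in> A \<Longrightarrow> f i \<in> H"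
  shows "finsum G f A \<in> H"
  using assms(2)
proof (induction A rule: infinite_finite_induct)
  case (insert a A)
  have sub: "H \<subseteq> carrier G" and add: "\<And>x y. \<lbrakk>x \<in> H; y \<in> H\<rbrakk> \<Longrightarrow> x \<oplus> y \<in> H"
    using additive_subgroup.a_subset[OF additive_subgroupI[OF assms(1)]]
      additive_subgroup.a_closed[OF additive_subgroupI[OF assms(1)]] by auto
  have "finsum G f (insert a A) = f a \<oplus> finsum G f A"
    by (rule finsum_insert) (use insert sub in auto)
  then show ?case
    using insert add by simp
qed (use additive_subgroup.zero_closed[OF additive_subgroupI[OF assms(1)]] in
    \<open>simp_all add: finsum_def finprod_def\<close>)

section \<open>Homogeneous components\<close>

text \<open>The value is meaningful when A decomposes M as an internal direct sum.\<close>

definition component ::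
    "('b, 'm) ring_scheme \<Rightarrow> ('i \<Rightarrow> 'b set) \<Rightarrow> 'i \<Rightarrow> 'b \<Rightarrow> 'b" where
  "component M A n x =
     (THE f. (\<forall>i. f i \<in> A i) \<and> finite {i. f i \<noteq> \<zero>\<^bsub>M\<^esub>} \<and>
        x = (\<Oplus>\<^bsub>M\<^esub>i \<in> {i. f i \<noteq> \<zero>\<^bsub>M\<^esub>}. f i)) n"

locale direct_decomposition = abelian_group G for G (structure) +
  fixes A :: "'i \<Rightarrow> 'a set"
  assumes decomposition: "internal_direct_sum G A"
begin

lemma summand_subgroup: "subgroup (A i) (add_monoid G)"
  using decomposition by (simp add: internal_direct_sum_def)

lemma summand_additive: "additive_subgroup (A i) G"
  by (rule additive_subgroupI[OF summand_subgroup])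

lemma summand_zero [simp]: "\<zero> \<in> A i"
  by (rule additive_subgroup.zero_closed[OF summand_additive])

lemma summand_add: "\<lbrakk>x \<in> A i; y \<in> A i\<rbrakk> \<Longrightarrow> x \<oplus> y \<in> A i"
  by (rule additive_subgroup.a_closed[OF summand_additive])

lemma summand_carrier: "x \<in> A i \<Longrightarrow> x \<in> carrier G"
  using additive_subgroup.a_subset[OF summand_additive] by blast

lemma component_eqI:
  assumes "\<And>i. f i \<in> A i" "finite {i. f i \<noteq> \<zero>}" "x = (\<Oplus>i \<in> {i. f i \<noteq> \<zero>}. f i)"
  shows "component G A n x = f n"
proof -
  have x: "x \<in> carrier G"
    unfolding assms(3) using summand_carrier assms(1) by (intro finsum_closed) auto
  have "(THE f. (\<forall>i. f i \<in> A i) \<and> finite {i. f i \<noteq> \<zero>} \<and> x = (\<Oplus>i \<in> {i. f i \<noteq> \<zero>}. f i)) = f"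
    by (rule the1_equality) (use decomposition x assms in \<open>auto simp: internal_direct_sum_def\<close>)
  then show ?thesis
    by (simp add: component_def)
qed

lemma
  assumes "x \<in> carrier G"
  shows component_in: "component G A n x \<in> A n"
    and component_finite: "finite {n. component G A n x \<noteq> \<zero>}"
    and component_sum: "x = (\<Oplus>n \<in> {n. component G A n x \<noteq> \<zero>}. component G A n x)"
proof -
  obtain f where f: "\<And>i. f i \<in> A i" "finite {i. f i \<noteq> \<zero>}" "x = (\<Oplus>i \<in> {i. f i \<noteq> \<zero>}. f i)"
    using decomposition assms unfolding internal_direct_sum_def by blast
  have eq: "component G A n x = f n" for n
    by (rule component_eqI[OF f])
  show "component G A n x \<in> A n" "finite {n. component G A n x \<noteq> \<zero>}"
    "x = (\<Oplus>n \<in> {n. component G A n x \<noteq> \<zero>}. component G A n x)"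
    unfolding eq using f by blast+
qed

lemma component_homogeneous:
  assumes "x \<in> A m"
  shows "component G A n x = (if n = m then x else \<zero>)"
proof (rule component_eqI)
  have "finsum G (\<lambda>i. if i = m then x else \<zero>) {i. (if i = m then x else \<zero>) \<noteq> \<zero>} =
      finsum G (\<lambda>i. if i = m then x else \<zero>) {m}"
    using summand_carrier[OF assms] by (intro finsum_support) auto
  also have "\<dots> = x"
    using summand_carrier[OF assms] by (simp add: finsum_insert)
  finally show "x = finsum G (\<lambda>i. if i = m then x else \<zero>) {i. (if i = m then x else \<zero>) \<noteq> \<zero>}"
    by simp
qed (use assms in auto)

lemma component_add:
  assumes x: "x \<in> carrier G" and y: "y \<in> carrier G"
  shows "component G A n (x \<oplus> y) = component G A n x \<oplus> component G A n y"
proof (rule component_eqI)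
  let ?c = "\<lambda>n. component G A n x" and ?d = "\<lambda>n. component G A n y"
  let ?S = "{n. ?c n \<noteq> \<zero>} \<union> {n. ?d n \<noteq> \<zero>}"
  have c: "?c n \<in> carrier G" and d: "?d n \<in> carrier G" for n
    using component_in[OF x] component_in[OF y] summand_carrier by auto
  show "?c n \<oplus> ?d n \<in> A n" for n
    by (intro summand_add component_in x y)
  have S: "finite ?S" "{n. ?c n \<oplus> ?d n \<noteq> \<zero>} \<subseteq> ?S"
    using component_finite[OF x] component_finite[OF y] by auto
  then show "finite {n. ?c n \<oplus> ?d n \<noteq> \<zero>}"
    by (rule rev_finite_subset)
  have "x = finsum G ?c ?S"
    using component_sum[OF x] finsum_support[of ?S ?c] S c by auto
  moreover have "y = finsum G ?d ?S"
    using component_sum[OF y] finsum_support[of ?S ?d] S d by auto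
  moreover have "finsum G (\<lambda>n. ?c n \<oplus> ?d n) ?S = finsum G ?c ?S \<oplus> finsum G ?d ?S"
    using c d by (intro finsum_addf) auto
  moreover have "finsum G (\<lambda>n. ?c n \<oplus> ?d n) {n. ?c n \<oplus> ?d n \<noteq> \<zero>} = finsum G (\<lambda>n. ?c n \<oplus> ?d n) ?S"
    using S c d by (intro finsum_support) auto
  ultimately show "x \<oplus> y = (\<Oplus>n \<in> {n. ?c n \<oplus> ?d n \<noteq> \<zero>}. ?c n \<oplus> ?d n)"
    by simp
qed

lemma component_hom: "abelian_group_hom G G (component G A n)"
  by (intro abelian_group_hom_of_hom abelian_group_axioms)
    (auto simp: hom_def component_add intro: summand_carrier component_in)

lemma homogeneous_induct [consumes 1, case_names zero homogeneous add]:
  assumes "x \<in> carrier G" and "P \<zero>"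
    and "\<And>n x. x \<in> A n \<Longrightarrow> P x"
    and "\<And>x y. \<lbrakk>x \<in> carrier G; y \<in> carrier G; P x; P y\<rbrakk> \<Longrightarrow> P (x \<oplus> y)"
  shows "P x"
proof -
  have "P (finsum G (\<lambda>n. component G A n x) S)" if "finite S" for S
    using that
  proof induction
    case (insert a S)
    have "component G A n x \<in> carrier G" for n
      using component_in[OF assms(1)] summand_carrier by auto
    then show ?case
      using insert assms(3)[OF component_in[OF assms(1)]] assms(4) by (simp add: finsum_insert)
  qed (simp add: assms(2))
  from this[OF component_finite[OF assms(1)]] show ?thesis
    using component_sum[OF assms(1)] by simp
qed

end

text \<open>A map that respects two decompositions carries the decomposition of x to a decomposition of
  its image, and decompositions are unique. This is what allows homogeneous preimages to be found
  throughout: a preimage of a homogeneous element may be replaced by its component of that degree.\<close>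

lemma component_commute:
  assumes M: "direct_decomposition M A" and N: "direct_decomposition N B"
    and f: "f \<in> hom (add_monoid M) (add_monoid N)" and AB: "\<And>n. f ` A n \<subseteq> B n"
    and x: "x \<in> carrier M"
  shows "component N B n (f x) = f (component M A n x)"
proof (rule direct_decomposition.component_eqI[OF N])
  interpret M: direct_decomposition M A by fact
  interpret N: direct_decomposition N B by fact
  interpret f: abelian_group_hom M N f
    by (intro abelian_group_hom_of_hom f M.abelian_group_axioms N.abelian_group_axioms)
  let ?c = "\<lambda>n. component M A n x"
  have c: "?c n \<in> carrier M" for n
    using M.component_in[OF x] M.summand_carrier by auto
  show "f (?c n) \<in> B n" for n
    using M.component_in[OF x] AB by blast
  have S: "finite {n. ?c n \<noteq> \<zero>\<^bsub>M\<^esub>}" "{n. f (?c n) \<noteq> \<zero>\<^bsub>N\<^esub>} \<subseteq> {n. ?c n \<noteq> \<zero>\<^bsub>M\<^esub>}"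
    using M.component_finite[OF x] by auto
  then show "finite {n. f (?c n) \<noteq> \<zero>\<^bsub>N\<^esub>}"
    by (rule rev_finite_subset)
  have "f x = f (finsum M ?c {n. ?c n \<noteq> \<zero>\<^bsub>M\<^esub>})"
    using M.component_sum[OF x] by (rule arg_cong)
  also have "\<dots> = finsum N (\<lambda>n. f (?c n)) {n. ?c n \<noteq> \<zero>\<^bsub>M\<^esub>}"
    using c by (intro f.hom_finsum) auto
  also have "\<dots> = finsum N (\<lambda>n. f (?c n)) {n. f (?c n) \<noteq> \<zero>\<^bsub>N\<^esub>}"
    using S c by (intro N.finsum_support[symmetric]) auto
  finally show "f x = finsum N (\<lambda>n. f (?c n)) {n. f (?c n) \<noteq> \<zero>\<^bsub>N\<^esub>}" .
qed

section \<open>Graded modules and maps\<close>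

lemma (in left_module) smult_hom: "a \<in> carrier R \<Longrightarrow> abelian_group_hom M M (\<lambda>x. a \<odot>\<^bsub>M\<^esub> x)"
  by (intro abelian_group_hom_of_hom M.abelian_group_axioms) (auto simp: hom_def smult_r_distr)

lemma (in left_module) smult_zero [simp]: "a \<in> carrier R \<Longrightarrow> a \<odot>\<^bsub>M\<^esub> \<zero>\<^bsub>M\<^esub> = \<zero>\<^bsub>M\<^esub>"
  by (rule abelian_group_hom.hom_zero[OF smult_hom])

lemma (in left_module) zero_smult [simp]: "x \<in> carrier M \<Longrightarrow> \<zero> \<odot>\<^bsub>M\<^esub> x = \<zero>\<^bsub>M\<^esub>"
proof -
  assume x: "x \<in> carrier M"
  interpret h: abelian_group_hom R M "\<lambda>a. a \<odot>\<^bsub>M\<^esub> x"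
    using x by (intro abelian_group_hom_of_hom M.abelian_group_axioms R.is_abelian_group)
      (auto simp: hom_def smult_l_distr)
  show ?thesis
    by (rule h.hom_zero)
qed

sublocale graded_ring \<subseteq> rdeg: direct_decomposition R "rcomp R"
  using rcomp_direct_sum by unfold_locales

sublocale graded_module \<subseteq> deg: direct_decomposition M "mcomp M"
  using mcomp_direct_sum by unfold_locales

text \<open>Scalar multiplication by a is not a graded map but shifts degrees by i, so it does not fall
  under \<open>component_commute\<close>; checking the identity on homogeneous x suffices.\<close>

lemma (in graded_module) component_smult:
  assumes a: "a \<in> rcomp R i" and x: "x \<in> carrier M"
  shows "component M (mcomp M) n (a \<odot>\<^bsub>M\<^esub> x) = a \<odot>\<^bsub>M\<^esub> component M (mcomp M) (n - int i) x"
  using x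
proof (induction rule: deg.homogeneous_induct)
  have aR: "a \<in> carrier R"
    by (rule rdeg.summand_carrier[OF a])
  case zero
  show ?case
    using aR abelian_group_hom.hom_zero[OF deg.component_hom] by simp
next
  case (homogeneous m x)
  have "a \<in> carrier R"
    by (rule rdeg.summand_carrier[OF a])
  then show ?case
    using deg.component_homogeneous[OF homogeneous] deg.component_homogeneous[OF smult_mcomp[OF a homogeneous]]
    by auto
next
  case (add x y)
  have "a \<in> carrier R"
    by (rule rdeg.summand_carrier[OF a])
  moreover have "component M (mcomp M) k z \<in> carrier M" if "z \<in> carrier M" for k z
    by (rule deg.summand_carrier[OF deg.component_in[OF that]])
  ultimately show ?case
    using add by (simp add: smult_r_distr deg.component_add)
qed

lemma graded_hom_smult:
  "\<lbrakk>f \<in> graded_hom R M N; a \<in> carrier R; x \<in> carrier M\<rbrakk> \<Longrightarrow> f (a \<odot>\<^bsub>M\<^esub> x) = a \<odot>\<^bsub>N\<^esub> f x"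
  by (simp add: graded_hom_def)

lemma graded_hom_degree: "\<lbrakk>f \<in> graded_hom R M N; x \<in> mcomp M n\<rbrakk> \<Longrightarrow> f x \<in> mcomp N n"
  unfolding graded_hom_def by blast

lemma graded_hom_closed: "\<lbrakk>f \<in> graded_hom R M N; x \<in> carrier M\<rbrakk> \<Longrightarrow> f x \<in> carrier N"
  by (auto simp: graded_hom_def hom_def)

lemma graded_homI:
  assumes "\<And>x. x \<in> carrier M \<Longrightarrow> f x \<in> carrier N"
    and "\<And>x y. \<lbrakk>x \<in> carrier M; y \<in> carrier M\<rbrakk> \<Longrightarrow> f (x \<oplus>\<^bsub>M\<^esub> y) = f x \<oplus>\<^bsub>N\<^esub> f y"
    and "\<And>a x. \<lbrakk>a \<in> carrier R; x \<in> carrier M\<rbrakk> \<Longrightarrow> f (a \<odot>\<^bsub>M\<^esub> x) = a \<odot>\<^bsub>N\<^esub> f x"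
    and "\<And>n x. x \<in> mcomp M n \<Longrightarrow> f x \<in> mcomp N n"
  shows "f \<in> graded_hom R M N"
  using assms by (auto simp: graded_hom_def hom_def)

lemma graded_hom_compose:
  assumes f: "f \<in> graded_hom R L M" and g: "g \<in> graded_hom R M N"
  shows "(\<lambda>x. g (f x)) \<in> graded_hom R L N"
proof (rule graded_homI)
  fix x y assume "x \<in> carrier L" "y \<in> carrier L"
  then show "g (f (x \<oplus>\<^bsub>L\<^esub> y)) = g (f x) \<oplus>\<^bsub>N\<^esub> g (f y)"
    using f g by (auto simp: graded_hom_def hom_def Pi_iff)
qed (simp_all add: graded_hom_closed[OF f] graded_hom_closed[OF g] graded_hom_smult[OF f]
    graded_hom_smult[OF g] graded_hom_degree[OF f] graded_hom_degree[OF g])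

lemma graded_hom_additive:
  assumes "graded_module R M" "graded_module R N" "f \<in> graded_hom R M N"
  shows "abelian_group_hom M N f"
proof -
  interpret M: graded_module R M by fact
  interpret N: graded_module R N by fact
  show ?thesis
    using assms(3) by (intro abelian_group_hom_of_hom M.M.abelian_group_axioms N.M.abelian_group_axioms)
      (simp add: graded_hom_def)
qed

lemma graded_hom_component:
  assumes "graded_module R M" "graded_module R N" "f \<in> graded_hom R M N" "x \<in> carrier M"
  shows "component N (mcomp N) n (f x) = f (component M (mcomp M) n x)"
proof -
  interpret M: graded_module R M by fact
  interpret N: graded_module R N by fact
  show ?thesis
    using assms(3,4) by (intro component_commute M.deg.direct_decomposition_axioms
        N.deg.direct_decomposition_axioms) (auto simp: graded_hom_def)
qed

lemma zero_graded_hom: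
  assumes "graded_module R N"
  shows "(\<lambda>x. \<zero>\<^bsub>N\<^esub>) \<in> graded_hom R M N"
proof -
  interpret N: graded_module R N by fact
  show ?thesis
    by (rule graded_homI) simp_all
qed

section \<open>Lifting along graded relations\<close>

definition lincomb ::
    "('a, 'r) ring_scheme \<Rightarrow> ('a, 'b, 'm) module_scheme \<Rightarrow> 'i set \<Rightarrow> ('i \<Rightarrow> 'a) \<Rightarrow> ('i \<Rightarrow> 'b) \<Rightarrow> 'b" where
  "lincomb R M B c v = (\<Oplus>\<^bsub>M\<^esub>b \<in> {b \<in> B. c b \<noteq> \<zero>\<^bsub>R\<^esub>}. c b \<odot>\<^bsub>M\<^esub> v b)"

context left_module
begin

lemma lincomb_support:
  assumes "finite S" "{b \<in> B. c b \<noteq> \<zero>} \<subseteq> S" "S \<subseteq> B"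
    and "\<And>b. b \<in> B \<Longrightarrow> c b \<in> carrier R" "\<And>b. b \<in> B \<Longrightarrow> v b \<in> carrier M"
  shows "lincomb R M B c v = (\<Oplus>\<^bsub>M\<^esub>b\<in>S. c b \<odot>\<^bsub>M\<^esub> v b)"
  unfolding lincomb_def
  by (rule M.add.finprod_mono_neutral_cong_left) (use assms in auto)

lemma lincomb_closed:
  assumes "\<And>b. b \<in> B \<Longrightarrow> c b \<in> carrier R" "\<And>b. b \<in> B \<Longrightarrow> v b \<in> carrier M"
  shows "lincomb R M B c v \<in> carrier M"
  unfolding lincomb_def using assms by (intro M.finsum_closed) auto

lemma lincomb_add:
  assumes c: "finite {b \<in> B. c b \<noteq> \<zero>}" "\<And>b. b \<in> B \<Longrightarrow> c b \<in> carrier R"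
    and d: "finite {b \<in> B. d b \<noteq> \<zero>}" "\<And>b. b \<in> B \<Longrightarrow> d b \<in> carrier R"
    and v: "\<And>b. b \<in> B \<Longrightarrow> v b \<in> carrier M"
  shows "lincomb R M B (\<lambda>b\<in>B. c b \<oplus> d b) v = lincomb R M B c v \<oplus>\<^bsub>M\<^esub> lincomb R M B d v"
proof -
  let ?S = "{b \<in> B. c b \<noteq> \<zero>} \<union> {b \<in> B. d b \<noteq> \<zero>}"
  have "lincomb R M B (\<lambda>b\<in>B. c b \<oplus> d b) v = (\<Oplus>\<^bsub>M\<^esub>b\<in>?S. (\<lambda>b\<in>B. c b \<oplus> d b) b \<odot>\<^bsub>M\<^esub> v b)"
    by (rule lincomb_support) (use c d v in auto)
  also have "\<dots> = (\<Oplus>\<^bsub>M\<^esub>b\<in>?S. c b \<odot>\<^bsub>M\<^esub> v b \<oplus>\<^bsub>M\<^esub> d b \<odot>\<^bsub>M\<^esub> v b)"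
    by (rule M.finsum_cong') (use c d v in \<open>auto simp: smult_l_distr\<close>)
  also have "\<dots> = (\<Oplus>\<^bsub>M\<^esub>b\<in>?S. c b \<odot>\<^bsub>M\<^esub> v b) \<oplus>\<^bsub>M\<^esub> (\<Oplus>\<^bsub>M\<^esub>b\<in>?S. d b \<odot>\<^bsub>M\<^esub> v b)"
    by (rule M.finsum_addf) (use c d v in auto)
  also have "(\<Oplus>\<^bsub>M\<^esub>b\<in>?S. c b \<odot>\<^bsub>M\<^esub> v b) = lincomb R M B c v"
    by (rule lincomb_support[symmetric]) (use c d v in auto)
  also have "(\<Oplus>\<^bsub>M\<^esub>b\<in>?S. d b \<odot>\<^bsub>M\<^esub> v b) = lincomb R M B d v"
    by (rule lincomb_support[symmetric]) (use c d v in auto)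
  finally show ?thesis .
qed

lemma lincomb_smult:
  assumes a: "a \<in> carrier R" and c: "finite {b \<in> B. c b \<noteq> \<zero>}" "\<And>b. b \<in> B \<Longrightarrow> c b \<in> carrier R"
    and v: "\<And>b. b \<in> B \<Longrightarrow> v b \<in> carrier M"
  shows "lincomb R M B (\<lambda>b\<in>B. a \<otimes> c b) v = a \<odot>\<^bsub>M\<^esub> lincomb R M B c v"
proof -
  let ?S = "{b \<in> B. c b \<noteq> \<zero>}"
  have "lincomb R M B (\<lambda>b\<in>B. a \<otimes> c b) v = (\<Oplus>\<^bsub>M\<^esub>b\<in>?S. (\<lambda>b\<in>B. a \<otimes> c b) b \<odot>\<^bsub>M\<^esub> v b)"
    by (rule lincomb_support) (use a c v in auto)
  also have "\<dots> = (\<Oplus>\<^bsub>M\<^esub>b\<in>?S. a \<odot>\<^bsub>M\<^esub> (c b \<odot>\<^bsub>M\<^esub> v b))"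
    by (rule M.finsum_cong') (use a c v in \<open>auto simp: smult_assoc1\<close>)
  also have "\<dots> = a \<odot>\<^bsub>M\<^esub> (\<Oplus>\<^bsub>M\<^esub>b\<in>?S. c b \<odot>\<^bsub>M\<^esub> v b)"
    by (rule abelian_group_hom.hom_finsum[OF smult_hom[OF a], symmetric]) (use c v in auto)
  finally show ?thesis
    by (simp add: lincomb_def)
qed

lemma lincomb_single:
  assumes "b \<in> B" "\<And>b. b \<in> B \<Longrightarrow> v b \<in> carrier M"
  shows "lincomb R M B (\<lambda>b'\<in>B. if b' = b then \<one> else \<zero>) v = v b"
proof -
  have "lincomb R M B (\<lambda>b'\<in>B. if b' = b then \<one> else \<zero>) v
      = (\<Oplus>\<^bsub>M\<^esub>b'\<in>{b}. (\<lambda>b'\<in>B. if b' = b then \<one> else \<zero>) b' \<odot>\<^bsub>M\<^esub> v b')"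
    by (rule lincomb_support) (use assms in auto)
  then show ?thesis
    using assms by (simp add: M.finsum_insert)
qed

end

text \<open>The coefficients are extensional functions on the basis, as this makes them unique.\<close>

definition coordinates ::
    "('a, 'r) ring_scheme \<Rightarrow> ('a, 'b, 'm) module_scheme \<Rightarrow> 'b set \<Rightarrow> 'b \<Rightarrow> 'b \<Rightarrow> 'a" where
  "coordinates R M B x =
     (THE c. c \<in> B \<rightarrow>\<^sub>E carrier R \<and> finite {b \<in> B. c b \<noteq> \<zero>\<^bsub>R\<^esub>} \<and> x = lincomb R M B c (\<lambda>b. b))"

lemma (in graded_module)
  assumes B: "homogeneous_basis R M B" and x: "x \<in> carrier M"
  shows coordinates_closed: "b \<in> B \<Longrightarrow> coordinates R M B x b \<in> carrier R"
    and coordinates_finite: "finite {b \<in> B. coordinates R M B x b \<noteq> \<zero>}"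
    and coordinates_lincomb: "lincomb R M B (coordinates R M B x) (\<lambda>b. b) = x"
    and coordinates_eqI: "\<lbrakk>c \<in> B \<rightarrow>\<^sub>E carrier R; finite {b \<in> B. c b \<noteq> \<zero>}; x = lincomb R M B c (\<lambda>b. b)\<rbrakk>
      \<Longrightarrow> coordinates R M B x = c"
proof -
  let ?Q = "\<lambda>c. c \<in> B \<rightarrow>\<^sub>E carrier R \<and> finite {b \<in> B. c b \<noteq> \<zero>} \<and> x = lincomb R M B c (\<lambda>b. b)"
  have ex1: "\<exists>!c. ?Q c"
    using B x by (simp add: homogeneous_basis_def lincomb_def)
  have Q: "?Q (coordinates R M B x)"
    unfolding coordinates_def by (rule theI'[OF ex1])
  then show "b \<in> B \<Longrightarrow> coordinates R M B x b \<in> carrier R"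
    by (auto simp: PiE_iff)
  show "finite {b \<in> B. coordinates R M B x b \<noteq> \<zero>}"
    using Q by (elim conjE)
  show "lincomb R M B (coordinates R M B x) (\<lambda>b. b) = x"
    by (rule sym) (use Q in \<open>elim conjE\<close>)
  show "coordinates R M B x = c"
    if "c \<in> B \<rightarrow>\<^sub>E carrier R" "finite {b \<in> B. c b \<noteq> \<zero>}" "x = lincomb R M B c (\<lambda>b. b)"
    unfolding coordinates_def by (rule the1_equality[OF ex1]) (intro conjI that)
qed

text \<open>Projectivity of graded free modules, stated for relations instead of surjections. If G is
  compatible with the module operations, it is enough to solve the lifting problem for homogeneous
  elements in their own degree: the lifts of the basis elements extend linearly to a map \<open>\<phi>\<close> whose
  graph lies in G. A relation can impose several conditions on the value of \<open>\<phi>\<close> at once, which is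
  how the flag below is extended. That \<open>\<phi>\<close> preserves degrees is checked by showing that it
  commutes with taking components; this property passes from the basis to all linear combinations.\<close>

lemma graded_free_lift:
  assumes free: "graded_free R P" and N: "graded_module R N"
    and ex: "\<And>n y. y \<in> mcomp P n \<Longrightarrow> \<exists>z\<in>mcomp N n. G y z"
    and zero: "G \<zero>\<^bsub>P\<^esub> \<zero>\<^bsub>N\<^esub>"
    and add: "\<And>y z y' z'. \<lbrakk>y \<in> carrier P; z \<in> carrier N; y' \<in> carrier P; z' \<in> carrier N; G y z; G y' z'\<rbrakk>
        \<Longrightarrow> G (y \<oplus>\<^bsub>P\<^esub> y') (z \<oplus>\<^bsub>N\<^esub> z')"
    and smult: "\<And>a y z. \<lbrakk>a \<in> carrier R; y \<in> carrier P; z \<in> carrier N; G y z\<rbrakk>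
        \<Longrightarrow> G (a \<odot>\<^bsub>P\<^esub> y) (a \<odot>\<^bsub>N\<^esub> z)"
  shows "\<exists>\<phi>\<in>graded_hom R P N. \<forall>x\<in>carrier P. G x (\<phi> x)"
proof -
  interpret P: graded_module R P
    using free by (simp add: graded_free_def)
  interpret N: graded_module R N by fact
  obtain B where B: "homogeneous_basis R P B"
    using free by (auto simp: graded_free_def)
  have BP: "B \<subseteq> (\<Union>n. mcomp P n)"
    using B by (simp add: homogeneous_basis_def)
  have "\<exists>g n. b \<in> mcomp P n \<and> g \<in> mcomp N n \<and> G b g" if b: "b \<in> B" for b
  proof -
    obtain n where n: "b \<in> mcomp P n"
      using BP b by blast
    then show ?thesis
      using ex[OF n] by blast
  qed
  then obtain g deg where
    g: "\<And>b. b \<in> B \<Longrightarrow> b \<in> mcomp P (deg b) \<and> g b \<in> mcomp N (deg b) \<and> G b (g b)"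
    by metis
  have bP: "\<And>b. b \<in> B \<Longrightarrow> b \<in> carrier P" and gN: "\<And>b. b \<in> B \<Longrightarrow> g b \<in> carrier N"
    using g P.deg.summand_carrier N.deg.summand_carrier by blast+
  let ?coord = "coordinates R P B"
  note c2 = P.coordinates_finite[OF B] and c3 = P.coordinates_lincomb[OF B]
    and c4 = P.coordinates_eqI[OF B] and cR = P.coordinates_closed[OF B]
  define \<phi> where "\<phi> x = lincomb R N B (?coord x) g" for x
  have closed: "\<phi> x \<in> carrier N" if "x \<in> carrier P" for x
    unfolding \<phi>_def using that cR gN by (intro N.lincomb_closed) auto
  have hadd: "\<phi> (x \<oplus>\<^bsub>P\<^esub> y) = \<phi> x \<oplus>\<^bsub>N\<^esub> \<phi> y" if x: "x \<in> carrier P" and y: "y \<in> carrier P" for x y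
  proof -
    have "finite ({b \<in> B. ?coord x b \<noteq> \<zero>\<^bsub>R\<^esub>} \<union> {b \<in> B. ?coord y b \<noteq> \<zero>\<^bsub>R\<^esub>})"
      using c2 x y by blast
    then have fin: "finite {b \<in> B. (\<lambda>b\<in>B. ?coord x b \<oplus>\<^bsub>R\<^esub> ?coord y b) b \<noteq> \<zero>\<^bsub>R\<^esub>}"
      by (rule rev_finite_subset) (use cR x y in auto)
    have "?coord (x \<oplus>\<^bsub>P\<^esub> y) = (\<lambda>b\<in>B. ?coord x b \<oplus>\<^bsub>R\<^esub> ?coord y b)"
    proof (rule c4)
      show "x \<oplus>\<^bsub>P\<^esub> y = lincomb R P B (\<lambda>b\<in>B. ?coord x b \<oplus>\<^bsub>R\<^esub> ?coord y b) (\<lambda>b. b)"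
        using P.lincomb_add[of B "?coord x" "?coord y" "\<lambda>b. b"] c2 cR x y bP
        by (simp add: c3[OF x] c3[OF y])
    qed (use x y cR fin in auto)
    then show ?thesis
      unfolding \<phi>_def using c2 cR x y gN by (simp add: N.lincomb_add)
  qed
  have hsmult: "\<phi> (a \<odot>\<^bsub>P\<^esub> x) = a \<odot>\<^bsub>N\<^esub> \<phi> x" if a: "a \<in> carrier R" and x: "x \<in> carrier P" for a x
  proof -
    have fin: "finite {b \<in> B. (\<lambda>b\<in>B. a \<otimes>\<^bsub>R\<^esub> ?coord x b) b \<noteq> \<zero>\<^bsub>R\<^esub>}"
      by (rule rev_finite_subset[OF c2[OF x]]) (use cR x a in auto)
    have "?coord (a \<odot>\<^bsub>P\<^esub> x) = (\<lambda>b\<in>B. a \<otimes>\<^bsub>R\<^esub> ?coord x b)"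
    proof (rule c4)
      show "a \<odot>\<^bsub>P\<^esub> x = lincomb R P B (\<lambda>b\<in>B. a \<otimes>\<^bsub>R\<^esub> ?coord x b) (\<lambda>b. b)"
        using P.lincomb_smult[of a B "?coord x" "\<lambda>b. b"] c2 cR x a bP
        by (simp add: c3[OF x])
    qed (use x a cR fin in auto)
    then show ?thesis
      unfolding \<phi>_def using c2 cR x a gN by (simp add: N.lincomb_smult)
  qed
  have hbasis: "\<phi> b = g b" if b: "b \<in> B" for b
  proof -
    have "?coord b = (\<lambda>b'\<in>B. if b' = b then \<one>\<^bsub>R\<^esub> else \<zero>\<^bsub>R\<^esub>)"
    proof (rule c4)
      show "finite {b' \<in> B. (\<lambda>b'\<in>B. if b' = b then \<one>\<^bsub>R\<^esub> else \<zero>\<^bsub>R\<^esub>) b' \<noteq> \<zero>\<^bsub>R\<^esub>}"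
        by (rule finite_subset[of _ "{b}"]) auto
    qed (use b bP P.lincomb_single[of b B "\<lambda>b. b"] in auto)
    then show ?thesis
      unfolding \<phi>_def using N.lincomb_single[of b B g] b gN by simp
  qed
  \<comment> \<open>A basis generates: a property that holds on it and survives the operations holds everywhere.\<close>
  have span: "Q x" if x: "x \<in> carrier P" and "Q \<zero>\<^bsub>P\<^esub>" and "\<And>b. b \<in> B \<Longrightarrow> Q b"
    and "\<And>x y. \<lbrakk>x \<in> carrier P; y \<in> carrier P; Q x; Q y\<rbrakk> \<Longrightarrow> Q (x \<oplus>\<^bsub>P\<^esub> y)"
    and "\<And>a x. \<lbrakk>a \<in> carrier R; x \<in> carrier P; Q x\<rbrakk> \<Longrightarrow> Q (a \<odot>\<^bsub>P\<^esub> x)" for Q x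
  proof -
    have "Q (\<Oplus>\<^bsub>P\<^esub>b\<in>S. ?coord x b \<odot>\<^bsub>P\<^esub> b)" if "finite S" "S \<subseteq> B" for S
      using that
    proof induction
      case (insert b S)
      have "(\<lambda>b. ?coord x b \<odot>\<^bsub>P\<^esub> b) \<in> S \<rightarrow> carrier P"
        using insert.prems bP cR x by auto
      then show ?case
        using insert bP cR x \<open>\<And>b. b \<in> B \<Longrightarrow> Q b\<close>
          \<open>\<And>x y. \<lbrakk>x \<in> carrier P; y \<in> carrier P; Q x; Q y\<rbrakk> \<Longrightarrow> Q (x \<oplus>\<^bsub>P\<^esub> y)\<close>
          \<open>\<And>a x. \<lbrakk>a \<in> carrier R; x \<in> carrier P; Q x\<rbrakk> \<Longrightarrow> Q (a \<odot>\<^bsub>P\<^esub> x)\<close>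
        by (simp add: P.M.finsum_insert)
    qed (simp add: \<open>Q \<zero>\<^bsub>P\<^esub>\<close>)
    from this[OF c2[OF x]] show ?thesis
      using c3[OF x, symmetric, unfolded lincomb_def] by simp
  qed
  have hzero: "\<phi> \<zero>\<^bsub>P\<^esub> = \<zero>\<^bsub>N\<^esub>"
    using hsmult[of "\<zero>\<^bsub>R\<^esub>" "\<zero>\<^bsub>P\<^esub>"] closed by simp
  have rel: "G x (\<phi> x)" if "x \<in> carrier P" for x
    using that by (rule span) (use zero hzero g hbasis add hadd smult hsmult closed in auto)
  have comp: "\<forall>n. component N (mcomp N) n (\<phi> x) = \<phi> (component P (mcomp P) n x)"
    if "x \<in> carrier P" for x
    using that
  proof (rule span)
    show "\<forall>n. component N (mcomp N) n (\<phi> \<zero>\<^bsub>P\<^esub>) = \<phi> (component P (mcomp P) n \<zero>\<^bsub>P\<^esub>)"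
      using hzero abelian_group_hom.hom_zero[OF N.deg.component_hom]
        abelian_group_hom.hom_zero[OF P.deg.component_hom] by simp
    show "\<forall>n. component N (mcomp N) n (\<phi> b) = \<phi> (component P (mcomp P) n b)" if "b \<in> B" for b
      using g[OF that] hbasis[OF that] hzero
        N.deg.component_homogeneous[of "g b" "deg b"] P.deg.component_homogeneous[of b "deg b"]
      by auto
  next
    fix x y
    assume *: "x \<in> carrier P" "y \<in> carrier P"
      "\<forall>n. component N (mcomp N) n (\<phi> x) = \<phi> (component P (mcomp P) n x)"
      "\<forall>n. component N (mcomp N) n (\<phi> y) = \<phi> (component P (mcomp P) n y)"
    then show "\<forall>n. component N (mcomp N) n (\<phi> (x \<oplus>\<^bsub>P\<^esub> y)) = \<phi> (component P (mcomp P) n (x \<oplus>\<^bsub>P\<^esub> y))"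
      using P.deg.summand_carrier[OF P.deg.component_in]
      by (simp add: hadd closed N.deg.component_add P.deg.component_add)
  next
    fix a x
    assume a: "a \<in> carrier R" and x: "x \<in> carrier P"
      and IH: "\<forall>n. component N (mcomp N) n (\<phi> x) = \<phi> (component P (mcomp P) n x)"
    have cP: "component P (mcomp P) n y \<in> carrier P" if "y \<in> carrier P" for n y
      by (rule P.deg.summand_carrier[OF P.deg.component_in[OF that]])
    \<comment> \<open>The scalar need not be homogeneous, so it is split into components as well.\<close>
    show "\<forall>n. component N (mcomp N) n (\<phi> (a \<odot>\<^bsub>P\<^esub> x)) = \<phi> (component P (mcomp P) n (a \<odot>\<^bsub>P\<^esub> x))"
      using a
    proof (induction rule: P.rdeg.homogeneous_induct)
      case zero
      then show ?case
        using x hzero abelian_group_hom.hom_zero[OF N.deg.component_hom]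
        abelian_group_hom.hom_zero[OF P.deg.component_hom] by simp
    next
      case (homogeneous i a)
      then have "a \<in> carrier R"
        by (rule P.rdeg.summand_carrier)
      then show ?case
        using x IH homogeneous closed cP
        by (simp add: hsmult N.component_smult P.component_smult)
    next
      case (add a b)
      then show ?case
        using x closed cP by (simp add: P.smult_l_distr hadd N.deg.component_add P.deg.component_add)
    qed
  qed
  have "\<phi> \<in> graded_hom R P N"
  proof (rule graded_homI)
    fix n x
    assume x: "x \<in> mcomp P n"
    then have xP: "x \<in> carrier P"
      by (rule P.deg.summand_carrier)
    have "component N (mcomp N) n (\<phi> x) = \<phi> x"
      using comp[OF xP] P.deg.component_homogeneous[OF x] by simp
    then show "\<phi> x \<in> mcomp N n"
      using N.deg.component_in[OF closed[OF xP], of n] by simp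
  qed (use closed hadd hsmult in auto)
  with rel show ?thesis
    by blast
qed

section \<open>Direct sums of graded modules\<close>

lemma direct_sum_carrier:
  "x \<in> carrier (direct_sum F) \<longleftrightarrow> (\<forall>i. x i \<in> carrier (F i)) \<and> finite {i. x i \<noteq> \<zero>\<^bsub>F i\<^esub>}"
  by (simp add: direct_sum_def Let_def)

lemma direct_sum_mcomp:
  "x \<in> mcomp (direct_sum F) n \<longleftrightarrow> x \<in> carrier (direct_sum F) \<and> (\<forall>i. x i \<in> mcomp (F i) n)"
  by (simp add: direct_sum_def Let_def)

lemma direct_sum_apply [simp]:
  "\<zero>\<^bsub>direct_sum F\<^esub> i = \<zero>\<^bsub>F i\<^esub>"
  "(x \<oplus>\<^bsub>direct_sum F\<^esub> y) i = x i \<oplus>\<^bsub>F i\<^esub> y i"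
  "(a \<odot>\<^bsub>direct_sum F\<^esub> x) i = a \<odot>\<^bsub>F i\<^esub> x i"
  by (simp_all add: direct_sum_def Let_def)

locale graded_family = graded_ring R for R :: "'a gring" (structure) +
  fixes F :: "nat \<Rightarrow> ('a, 'b) gmodule"
  assumes summand_graded: "graded_module R (F i)"

sublocale graded_family \<subseteq> F: graded_module R "F i" for i
  by (rule summand_graded)

context graded_family
begin

abbreviation "S \<equiv> direct_sum F"

lemma S_apply_closed [simp]: "x \<in> carrier S \<Longrightarrow> x i \<in> carrier (F i)"
  by (simp add: direct_sum_carrier)

lemma S_zero: "\<zero>\<^bsub>S\<^esub> \<in> carrier S"
  by (simp add: direct_sum_carrier)

lemma S_add:
  assumes "x \<in> carrier S" "y \<in> carrier S"
  shows "x \<oplus>\<^bsub>S\<^esub> y \<in> carrier S"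
proof -
  have "finite ({i. x i \<noteq> \<zero>\<^bsub>F i\<^esub>} \<union> {i. y i \<noteq> \<zero>\<^bsub>F i\<^esub>})"
    using assms by (simp add: direct_sum_carrier)
  then have "finite {i. x i \<oplus>\<^bsub>F i\<^esub> y i \<noteq> \<zero>\<^bsub>F i\<^esub>}"
    by (rule rev_finite_subset) auto
  then show ?thesis
    using assms by (simp add: direct_sum_carrier)
qed

lemma S_smult:
  assumes "a \<in> carrier R" "x \<in> carrier S"
  shows "a \<odot>\<^bsub>S\<^esub> x \<in> carrier S"
proof -
  have "finite {i. x i \<noteq> \<zero>\<^bsub>F i\<^esub>}"
    using assms by (simp add: direct_sum_carrier)
  then have "finite {i. a \<odot>\<^bsub>F i\<^esub> x i \<noteq> \<zero>\<^bsub>F i\<^esub>}"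
    by (rule rev_finite_subset) (use assms in auto)
  then show ?thesis
    using assms by (simp add: direct_sum_carrier)
qed

lemma S_neg:
  assumes "x \<in> carrier S"
  shows "(\<lambda>i. \<ominus>\<^bsub>F i\<^esub> x i) \<in> carrier S"
proof -
  have "finite {i. x i \<noteq> \<zero>\<^bsub>F i\<^esub>}"
    using assms by (simp add: direct_sum_carrier)
  then have "finite {i. \<ominus>\<^bsub>F i\<^esub> x i \<noteq> \<zero>\<^bsub>F i\<^esub>}"
    by (rule rev_finite_subset) auto
  then show ?thesis
    using assms by (simp add: direct_sum_carrier)
qed

lemma S_abelian_group: "abelian_group S"
proof (rule abelian_groupI)
  fix x assume x: "x \<in> carrier S"
  show "\<exists>y\<in>carrier S. y \<oplus>\<^bsub>S\<^esub> x = \<zero>\<^bsub>S\<^esub>"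
    by (rule bexI[OF _ S_neg[OF x]]) (use x in \<open>simp add: fun_eq_iff F.M.l_neg\<close>)
qed (auto simp: S_add S_zero fun_eq_iff F.M.a_ac)

lemma S_left_module: "left_module R S"
proof -
  interpret S: abelian_group S by (rule S_abelian_group)
  show ?thesis
    by unfold_locales
      (auto simp: S_smult fun_eq_iff F.smult_l_distr F.smult_r_distr F.smult_assoc1)
qed

interpretation S: left_module R S by (rule S_left_module)

lemma proj_hom: "abelian_group_hom S (F i) (\<lambda>x. x i)"
  by (intro abelian_group_hom_of_hom S.M.abelian_group_axioms F.M.abelian_group_axioms)
    (auto simp: hom_def)

lemma S_uminus_apply: "x \<in> carrier S \<Longrightarrow> (\<ominus>\<^bsub>S\<^esub> x) i = \<ominus>\<^bsub>F i\<^esub> x i"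
  by (rule abelian_group_hom.hom_a_inv[OF proj_hom])

lemma S_minus_apply: "\<lbrakk>x \<in> carrier S; y \<in> carrier S\<rbrakk> \<Longrightarrow> (x \<ominus>\<^bsub>S\<^esub> y) i = x i \<ominus>\<^bsub>F i\<^esub> y i"
  by (rule abelian_group_hom.hom_minus[OF proj_hom])

lemma S_finsum_apply:
  "f \<in> A \<rightarrow> carrier S \<Longrightarrow> (finsum S f A) i = finsum (F i) (\<lambda>n. f n i) A"
  by (rule abelian_group_hom.hom_finsum[OF proj_hom])

lemma S_mcomp_subgroup: "subgroup (mcomp S n) (add_monoid S)"
proof (rule group.subgroupI[OF S.M.a_group])
  have "\<zero>\<^bsub>S\<^esub> \<in> mcomp S n"
    by (simp add: direct_sum_mcomp)
  then show "mcomp S n \<noteq> {}"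
    by blast
  show "inv\<^bsub>add_monoid S\<^esub> x \<in> mcomp S n" if "x \<in> mcomp S n" for x
    using that additive_subgroup.a_inv_closed[OF F.deg.summand_additive]
    by (simp add: direct_sum_mcomp S_uminus_apply flip: a_inv_def)
qed (auto simp: direct_sum_mcomp F.deg.summand_add)

text \<open>The decomposition is taken coordinatewise. It is finite because only finitely many coordinates
  are nonzero and each of them has finitely many nonzero components.\<close>

lemma S_internal_direct_sum: "internal_direct_sum S (mcomp S)"
  unfolding internal_direct_sum_def
proof (intro conjI allI ballI S_mcomp_subgroup)
  fix x
  assume x: "x \<in> carrier S"
  have mcomp_S: "\<And>n y. y \<in> mcomp S n \<Longrightarrow> y \<in> carrier S"
    by (simp add: direct_sum_mcomp)
  define f where "f n i = component (F i) (mcomp (F i)) n (x i)" for n i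
  have fF: "f n i \<in> mcomp (F i) n" for n i
    unfolding f_def using x by (intro F.deg.component_in) simp
  have f: "f n \<in> mcomp S n" for n
  proof -
    have "finite {i. x i \<noteq> \<zero>\<^bsub>F i\<^esub>}"
      using x by (simp add: direct_sum_carrier)
    then have "finite {i. f n i \<noteq> \<zero>\<^bsub>F i\<^esub>}"
      by (rule rev_finite_subset) (auto simp: f_def abelian_group_hom.hom_zero[OF F.deg.component_hom])
    then show ?thesis
      using fF F.deg.summand_carrier[OF fF] by (simp add: direct_sum_mcomp direct_sum_carrier)
  qed
  have "finite (\<Union>i\<in>{i. x i \<noteq> \<zero>\<^bsub>F i\<^esub>}. {n. f n i \<noteq> \<zero>\<^bsub>F i\<^esub>})"
    using x unfolding f_def by (intro finite_UN_I F.deg.component_finite) (simp_all add: direct_sum_carrier)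
  then have fin: "finite {n. f n \<noteq> \<zero>\<^bsub>S\<^esub>}"
  proof (rule rev_finite_subset, intro subsetI)
    fix n assume "n \<in> {n. f n \<noteq> \<zero>\<^bsub>S\<^esub>}"
    then obtain i where i: "f n i \<noteq> \<zero>\<^bsub>F i\<^esub>"
      by (auto simp: fun_eq_iff)
    then have "x i \<noteq> \<zero>\<^bsub>F i\<^esub>"
      by (auto simp: f_def abelian_group_hom.hom_zero[OF F.deg.component_hom])
    then show "n \<in> (\<Union>i\<in>{i. x i \<noteq> \<zero>\<^bsub>F i\<^esub>}. {n. f n i \<noteq> \<zero>\<^bsub>F i\<^esub>})"
      using i by blast
  qed
  have supp: "finsum S g {n. g n \<noteq> \<zero>\<^bsub>S\<^esub>} i = finsum (F i) (\<lambda>n. g n i) {n. g n i \<noteq> \<zero>\<^bsub>F i\<^esub>}"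
    if g: "\<And>n. g n \<in> mcomp S n" "finite {n. g n \<noteq> \<zero>\<^bsub>S\<^esub>}" for g i
  proof -
    have "finsum S g {n. g n \<noteq> \<zero>\<^bsub>S\<^esub>} i = finsum (F i) (\<lambda>n. g n i) {n. g n \<noteq> \<zero>\<^bsub>S\<^esub>}"
      using mcomp_S[OF g(1)] by (intro S_finsum_apply) auto
    also have "\<dots> = finsum (F i) (\<lambda>n. g n i) {n. g n i \<noteq> \<zero>\<^bsub>F i\<^esub>}"
      using mcomp_S[OF g(1)] g(2) by (intro F.M.finsum_support[symmetric]) auto
    finally show ?thesis .
  qed
  show "\<exists>!f. (\<forall>n. f n \<in> mcomp S n) \<and> finite {n. f n \<noteq> \<zero>\<^bsub>S\<^esub>} \<and> x = finsum S f {n. f n \<noteq> \<zero>\<^bsub>S\<^esub>}"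
  proof (rule ex1I[of _ f], intro conjI allI f fin)
    have "x i = finsum S f {n. f n \<noteq> \<zero>\<^bsub>S\<^esub>} i" for i
      unfolding supp[OF f fin] unfolding f_def
      by (rule F.deg.component_sum) (use x in simp)
    then show "x = finsum S f {n. f n \<noteq> \<zero>\<^bsub>S\<^esub>}"
      by (rule ext)
  next
    fix g
    assume "(\<forall>n. g n \<in> mcomp S n) \<and> finite {n. g n \<noteq> \<zero>\<^bsub>S\<^esub>} \<and> x = finsum S g {n. g n \<noteq> \<zero>\<^bsub>S\<^esub>}"
    then have g: "\<And>n. g n \<in> mcomp S n" and fin_g: "finite {n. g n \<noteq> \<zero>\<^bsub>S\<^esub>}"
      and sum_g: "finsum S g {n. g n \<noteq> \<zero>\<^bsub>S\<^esub>} = x"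
      by auto
    have "f n i = g n i" for n i
      unfolding f_def
    proof (rule F.deg.component_eqI)
      show "g n i \<in> mcomp (F i) n" for n
        using g by (simp add: direct_sum_mcomp)
      show "finite {n. g n i \<noteq> \<zero>\<^bsub>F i\<^esub>}"
        by (rule rev_finite_subset[OF fin_g]) auto
      show "x i = (\<Oplus>\<^bsub>F i\<^esub>n\<in>{n. g n i \<noteq> \<zero>\<^bsub>F i\<^esub>}. g n i)"
        using supp[OF g fin_g, of i] sum_g by simp
    qed
    then show "g = f"
      by (simp add: fun_eq_iff)
  qed
qed

lemma S_graded_module: "graded_module R S"
proof (intro graded_module.intro graded_ring_axioms S_left_module graded_module_axioms.intro
    S_internal_direct_sum)
  fix a i x n
  assume "a \<in> rcomp R i" "x \<in> mcomp S n"
  then show "a \<odot>\<^bsub>S\<^esub> x \<in> mcomp S (int i + n)"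
    using S_smult[OF rdeg.summand_carrier] F.smult_mcomp unfolding direct_sum_mcomp by simp
qed

end

sublocale graded_family \<subseteq> S: graded_module R "direct_sum F"
  by (rule S_graded_module)

context graded_family
begin

lemma proj_graded_hom: "(\<lambda>x. x i) \<in> graded_hom R S (F i)"
  by (rule graded_homI) (simp_all add: direct_sum_mcomp)

abbreviation "incl \<equiv> summand_incl F"

lemma incl_apply: "incl i y j = (if j = i then y else \<zero>\<^bsub>F j\<^esub>)"
  by (simp add: summand_incl_def)

lemma incl_closed [simp]: "y \<in> carrier (F i) \<Longrightarrow> incl i y \<in> carrier S"
proof -
  assume y: "y \<in> carrier (F i)"
  have "finite {j. incl i y j \<noteq> \<zero>\<^bsub>F j\<^esub>}"
    by (rule finite_subset[of _ "{i}"]) (auto simp: incl_apply)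
  then show ?thesis
    unfolding direct_sum_carrier using y by (simp add: incl_apply)
qed

lemma incl_graded_hom: "incl i \<in> graded_hom R (F i) S"
  by (rule graded_homI)
    (auto simp: direct_sum_mcomp incl_apply fun_eq_iff intro: incl_closed F.deg.summand_carrier)

text \<open>The submodule of the first k summands. The flag is built along this filtration, and the
  arguments about the flag are inductions along it.\<close>

definition below :: "nat \<Rightarrow> (nat \<Rightarrow> 'b) set" where
  "below k = {x \<in> carrier S. \<forall>j\<ge>k. x j = \<zero>\<^bsub>F j\<^esub>}"

lemma below_closed: "x \<in> below k \<Longrightarrow> x \<in> carrier S"
  by (simp add: below_def)

lemma below_apply: "\<lbrakk>x \<in> below k; k \<le> j\<rbrakk> \<Longrightarrow> x j = \<zero>\<^bsub>F j\<^esub>"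
  by (simp add: below_def)

lemma belowI: "\<lbrakk>x \<in> carrier S; \<And>j. k \<le> j \<Longrightarrow> x j = \<zero>\<^bsub>F j\<^esub>\<rbrakk> \<Longrightarrow> x \<in> below k"
  by (simp add: below_def)

lemma below_zero: "\<zero>\<^bsub>S\<^esub> \<in> below k"
  by (simp add: below_def)

lemma below_add: "\<lbrakk>x \<in> below k; y \<in> below k\<rbrakk> \<Longrightarrow> x \<oplus>\<^bsub>S\<^esub> y \<in> below k"
  by (simp add: below_def)

lemma below_minus: "\<lbrakk>x \<in> below k; y \<in> below k\<rbrakk> \<Longrightarrow> x \<ominus>\<^bsub>S\<^esub> y \<in> below k"
  by (simp add: below_def S_minus_apply F.M.minus_eq)

lemma below_smult: "\<lbrakk>a \<in> carrier R; x \<in> below k\<rbrakk> \<Longrightarrow> a \<odot>\<^bsub>S\<^esub> x \<in> below k"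
  by (simp add: below_def)

lemma below_mono: "\<lbrakk>x \<in> below k; k \<le> l\<rbrakk> \<Longrightarrow> x \<in> below l"
  by (simp add: below_def)

(* Up to eta-contraction these rules would also unfold the operations where they are not applied
   to an index, and facts about the direct sum as a module would no longer match. *)
declare direct_sum_apply [simp del]

lemma below_0: "x \<in> below 0 \<longleftrightarrow> x = \<zero>\<^bsub>S\<^esub>"
proof
  assume "x \<in> below 0"
  then show "x = \<zero>\<^bsub>S\<^esub>"
    by (intro ext) (simp add: below_apply direct_sum_apply)
qed (simp add: below_zero)

lemma below_Suc: "\<lbrakk>x \<in> below (Suc k); x k = \<zero>\<^bsub>F k\<^esub>\<rbrakk> \<Longrightarrow> x \<in> below k"
  by (rule belowI) (auto simp: below_closed, metis below_apply le_eq_less_or_eq Suc_leI)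

declare below_closed [simp] below_apply [simp] below_zero [simp]

lemma incl_below: "\<lbrakk>y \<in> carrier (F i); i < k\<rbrakk> \<Longrightarrow> incl i y \<in> below k"
  by (auto intro!: belowI simp: incl_apply)

lemma below_exhaust:
  assumes "x \<in> carrier S"
  obtains k where "x \<in> below k"
proof -
  have "finite {i. x i \<noteq> \<zero>\<^bsub>F i\<^esub>}"
    using assms by (simp add: direct_sum_carrier)
  then obtain k where "\<forall>i\<in>{i. x i \<noteq> \<zero>\<^bsub>F i\<^esub>}. i < k"
    using finite_nat_set_iff_bounded by blast
  then have "x \<in> below k"
    using assms by (intro belowI) fastforce+
  then show ?thesis
    by (rule that)
qed

lemma below_top:
  assumes "x \<in> below (Suc k)"
  shows "x \<ominus>\<^bsub>S\<^esub> incl k (x k) \<in> below k"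
proof (rule below_Suc)
  show "x \<ominus>\<^bsub>S\<^esub> incl k (x k) \<in> below (Suc k)"
    using assms by (intro below_minus incl_below) simp_all
  show "(x \<ominus>\<^bsub>S\<^esub> incl k (x k)) k = \<zero>\<^bsub>F k\<^esub>"
    using assms by (simp add: S_minus_apply incl_apply F.M.minus_eq F.M.r_neg)
qed

text \<open>The index bound in the second case matters: statements about a flag are only known on the
  summands that have already been constructed.\<close>

lemma below_induct [consumes 1, case_names zero incl add]:
  assumes "x \<in> below k" and "P \<zero>\<^bsub>S\<^esub>"
    and incl: "\<And>i y. \<lbrakk>i < k; y \<in> carrier (F i)\<rbrakk> \<Longrightarrow> P (incl i y)"
    and add: "\<And>x y. \<lbrakk>x \<in> carrier S; y \<in> carrier S; P x; P y\<rbrakk> \<Longrightarrow> P (x \<oplus>\<^bsub>S\<^esub> y)"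
  shows "P x"
  using assms(1) incl
proof (induction k arbitrary: x)
  case 0
  then show ?case
    using \<open>P \<zero>\<^bsub>S\<^esub>\<close> by (simp add: below_0)
next
  case (Suc k)
  have x: "x \<in> carrier S"
    using Suc.prems by simp
  have "P (x \<ominus>\<^bsub>S\<^esub> incl k (x k))"
    by (rule Suc.IH[OF below_top[OF Suc.prems(1)]]) (use Suc.prems(2) in simp)
  moreover have "P (incl k (x k))"
    using Suc.prems(2) x by simp
  moreover have "x = (x \<ominus>\<^bsub>S\<^esub> incl k (x k)) \<oplus>\<^bsub>S\<^esub> incl k (x k)"
    using x by (simp add: S.M.minus_eq S.M.a_assoc S.M.l_neg)
  ultimately show ?case
    using add[of "x \<ominus>\<^bsub>S\<^esub> incl k (x k)" "incl k (x k)"] x by simp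
qed

lemma below_hom_closed:
  assumes x: "x \<in> below k" and H: "additive_subgroup H N" and h: "abelian_group_hom S N h"
    and "\<And>i y. \<lbrakk>i < k; y \<in> carrier (F i)\<rbrakk> \<Longrightarrow> h (incl i y) \<in> H"
  shows "h x \<in> H"
  using x
  by (induction rule: below_induct)
    (use assms abelian_group_hom.hom_zero[OF h] abelian_group_hom.hom_add[OF h]
      additive_subgroup.zero_closed[OF H] additive_subgroup.a_closed[OF H] in auto)

definition copair :: "('a, 'c) gmodule \<Rightarrow> (nat \<Rightarrow> 'b \<Rightarrow> 'c) \<Rightarrow> (nat \<Rightarrow> 'b) \<Rightarrow> 'c" where
  "copair N f x = (\<Oplus>\<^bsub>N\<^esub>i \<in> {i. x i \<noteq> \<zero>\<^bsub>F i\<^esub>}. f i (x i))"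

context
  fixes N :: "('a, 'c) gmodule" and f :: "nat \<Rightarrow> 'b \<Rightarrow> 'c"
  assumes N: "graded_module R N" and f: "\<And>i. f i \<in> graded_hom R (F i) N"
begin

interpretation N: graded_module R N by (rule N)

lemma copair_support:
  assumes "finite T" "{i. x i \<noteq> \<zero>\<^bsub>F i\<^esub>} \<subseteq> T" "x \<in> carrier S"
  shows "copair N f x = (\<Oplus>\<^bsub>N\<^esub>i\<in>T. f i (x i))"
  unfolding copair_def
  by (rule N.M.add.finprod_mono_neutral_cong_left)
    (use assms abelian_group_hom.hom_zero[OF graded_hom_additive[OF F.graded_module_axioms N f]]
      graded_hom_closed[OF f] in auto)

lemma copair_closed: "x \<in> carrier S \<Longrightarrow> copair N f x \<in> carrier N"
  unfolding copair_def using graded_hom_closed[OF f] by (intro N.M.finsum_closed) auto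

lemma copair_graded_hom: "copair N f \<in> graded_hom R S N"
proof (rule graded_homI)
  fix x y
  assume x: "x \<in> carrier S" and y: "y \<in> carrier S"
  let ?T = "{i. x i \<noteq> \<zero>\<^bsub>F i\<^esub>} \<union> {i. y i \<noteq> \<zero>\<^bsub>F i\<^esub>}"
  have T: "finite ?T"
    using x y by (simp add: direct_sum_carrier)
  have "copair N f (x \<oplus>\<^bsub>S\<^esub> y) = (\<Oplus>\<^bsub>N\<^esub>i\<in>?T. f i ((x \<oplus>\<^bsub>S\<^esub> y) i))"
    using x y by (intro copair_support T) (auto simp: direct_sum_apply)
  also have "\<dots> = (\<Oplus>\<^bsub>N\<^esub>i\<in>?T. f i (x i) \<oplus>\<^bsub>N\<^esub> f i (y i))"
    using x y graded_hom_closed[OF f]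
    by (intro N.M.finsum_cong')
      (auto simp: direct_sum_apply abelian_group_hom.hom_add[OF graded_hom_additive[OF F.graded_module_axioms N f]])
  also have "\<dots> = (\<Oplus>\<^bsub>N\<^esub>i\<in>?T. f i (x i)) \<oplus>\<^bsub>N\<^esub> (\<Oplus>\<^bsub>N\<^esub>i\<in>?T. f i (y i))"
    using x y graded_hom_closed[OF f] by (intro N.M.finsum_addf) auto
  also have "(\<Oplus>\<^bsub>N\<^esub>i\<in>?T. f i (x i)) = copair N f x"
    using x by (intro copair_support[symmetric] T) auto
  also have "(\<Oplus>\<^bsub>N\<^esub>i\<in>?T. f i (y i)) = copair N f y"
    using y by (intro copair_support[symmetric] T) auto
  finally show "copair N f (x \<oplus>\<^bsub>S\<^esub> y) = copair N f x \<oplus>\<^bsub>N\<^esub> copair N f y" .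
next
  fix a x
  assume a: "a \<in> carrier R" and x: "x \<in> carrier S"
  let ?T = "{i. x i \<noteq> \<zero>\<^bsub>F i\<^esub>}"
  have "copair N f (a \<odot>\<^bsub>S\<^esub> x) = (\<Oplus>\<^bsub>N\<^esub>i\<in>?T. f i ((a \<odot>\<^bsub>S\<^esub> x) i))"
    using a x by (intro copair_support) (auto simp: direct_sum_apply direct_sum_carrier[of x])
  also have "\<dots> = (\<Oplus>\<^bsub>N\<^esub>i\<in>?T. a \<odot>\<^bsub>N\<^esub> f i (x i))"
    using a x graded_hom_closed[OF f]
    by (intro N.M.finsum_cong') (auto simp: direct_sum_apply graded_hom_smult[OF f])
  also have "\<dots> = a \<odot>\<^bsub>N\<^esub> (\<Oplus>\<^bsub>N\<^esub>i\<in>?T. f i (x i))"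
    using a x graded_hom_closed[OF f]
    by (intro abelian_group_hom.hom_finsum[OF N.smult_hom, symmetric]) auto
  finally show "copair N f (a \<odot>\<^bsub>S\<^esub> x) = a \<odot>\<^bsub>N\<^esub> copair N f x"
    by (simp add: copair_def)
next
  fix n x
  assume "x \<in> mcomp S n"
  then show "copair N f x \<in> mcomp N n"
    unfolding copair_def
    by (intro N.M.subgroup_finsum_closed N.deg.summand_subgroup graded_hom_degree[OF f])
      (simp add: direct_sum_mcomp)
qed (rule copair_closed)

lemma copair_incl:
  assumes "y \<in> carrier (F i)"
  shows "copair N f (incl i y) = f i y"
proof -
  have "copair N f (incl i y) = (\<Oplus>\<^bsub>N\<^esub>j\<in>{i}. f j (incl i y j))"
    using assms by (intro copair_support) (auto simp: incl_apply)
  also have "\<dots> = f i y"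
    using assms graded_hom_closed[OF f] by (simp add: N.M.finsum_insert incl_apply)
  finally show ?thesis .
qed

lemma copair_cong:
  assumes "x \<in> below k" "\<And>i. i < k \<Longrightarrow> g i = f i"
  shows "copair N g x = copair N f x"
  unfolding copair_def
proof (rule N.M.finsum_cong')
  fix i assume "i \<in> {i. x i \<noteq> \<zero>\<^bsub>F i\<^esub>}"
  then have "i < k"
    using below_apply[OF assms(1)] by (meson mem_Collect_eq not_le)
  then show "g i (x i) = f i (x i)"
    by (simp add: assms(2))
qed (use assms(1) graded_hom_closed[OF f] in auto)

end

end

section \<open>Homology of differential modules\<close>

locale differential = graded_module R D for R :: "'a gring" (structure)
    and D :: "('a, 'b) gmodule" (structure) +
  fixes \<delta> :: "'b \<Rightarrow> 'b"
  assumes diff_graded_hom: "\<delta> \<in> graded_hom R D D"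
    and diff_square: "x \<in> carrier D \<Longrightarrow> \<delta> (\<delta> x) = \<zero>\<^bsub>D\<^esub>"

lemma differential_module_iff: "differential_module R D \<delta> \<longleftrightarrow> differential R D \<delta>"
  by (auto simp: differential_module_def differential_def differential_axioms_def)

sublocale differential \<subseteq> d: abelian_group_hom D D \<delta>
  by (rule graded_hom_additive[OF graded_module_axioms graded_module_axioms diff_graded_hom])

context differential
begin

abbreviation "boundaries \<equiv> \<delta> ` carrier D"

lemma kernel_iff: "x \<in> a_kernel D D \<delta> \<longleftrightarrow> x \<in> carrier D \<and> \<delta> x = \<zero>\<^bsub>D\<^esub>"
  by (auto simp: a_kernel_def')

lemma boundary_kernel: "x \<in> boundaries \<Longrightarrow> x \<in> a_kernel D D \<delta>"
  using diff_square by (auto simp: kernel_iff)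

lemma boundaries_subgroup: "additive_subgroup boundaries D"
  using group_hom.img_is_subgroup[OF d.a_group_hom] by (intro additive_subgroupI) simp

sublocale B: abelian_subgroup boundaries D
  by (intro abelian_subgroupI3 boundaries_subgroup M.abelian_group_axioms)

lemma boundary_smult: "\<lbrakk>a \<in> carrier R; x \<in> boundaries\<rbrakk> \<Longrightarrow> a \<odot>\<^bsub>D\<^esub> x \<in> boundaries"
  by (auto simp flip: graded_hom_smult[OF diff_graded_hom])

abbreviation "cls x \<equiv> boundaries +>\<^bsub>D\<^esub> x"

lemma cls_mem: "\<lbrakk>x \<in> carrier D; y \<in> carrier D\<rbrakk> \<Longrightarrow> y \<in> cls x \<longleftrightarrow> y \<ominus>\<^bsub>D\<^esub> x \<in> boundaries"
  by (simp add: B.a_rcos_module M.minus_eq)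

lemma cls_eq: "\<lbrakk>x \<in> carrier D; y \<in> carrier D\<rbrakk> \<Longrightarrow> cls y = cls x \<longleftrightarrow> y \<ominus>\<^bsub>D\<^esub> x \<in> boundaries"
  using cls_mem B.a_rcos_self M.a_repr_independence[OF _ _ B.a_subgroup] by metis

lemma cls_closed: "\<lbrakk>x \<in> carrier D; y \<in> cls x\<rbrakk> \<Longrightarrow> y \<in> carrier D"
  by (rule B.a_elemrcos_carrier)

lemma homology_carrier: "carrier (homology D \<delta>) = cls ` a_kernel D D \<delta>"
  by (auto simp: homology_def quotient_gmodule_def cycles_def A_RCOSETS_def' a_r_coset_def')

lemma homology_zero: "\<zero>\<^bsub>homology D \<delta>\<^esub> = boundaries"
  by (simp add: homology_def quotient_gmodule_def)

lemma homology_add: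
  "\<lbrakk>x \<in> carrier D; y \<in> carrier D\<rbrakk> \<Longrightarrow> cls x \<oplus>\<^bsub>homology D \<delta>\<^esub> cls y = cls (x \<oplus>\<^bsub>D\<^esub> y)"
  by (simp add: homology_def quotient_gmodule_def cycles_def B.a_rcos_sum[symmetric] set_add_def')

lemma homology_smult:
  assumes a: "a \<in> carrier R" and x: "x \<in> carrier D"
  shows "a \<odot>\<^bsub>homology D \<delta>\<^esub> cls x = cls (a \<odot>\<^bsub>D\<^esub> x)"
proof -
  have "cls (a \<odot>\<^bsub>D\<^esub> y) = cls (a \<odot>\<^bsub>D\<^esub> x)" if y: "y \<in> cls x" for y
  proof -
    have yD: "y \<in> carrier D"
      by (rule cls_closed[OF x y])
    have "a \<odot>\<^bsub>D\<^esub> (y \<ominus>\<^bsub>D\<^esub> x) \<in> boundaries"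
      using a x y yD by (intro boundary_smult) (simp_all flip: cls_mem)
    then show ?thesis
      using a x yD by (simp add: cls_eq abelian_group_hom.hom_minus[OF smult_hom])
  qed
  then have "(\<Union>y\<in>cls x. cls (a \<odot>\<^bsub>D\<^esub> y)) = cls (a \<odot>\<^bsub>D\<^esub> x)"
    using B.a_rcos_self[OF x] by blast
  then show ?thesis
    by (simp add: homology_def quotient_gmodule_def cycles_def a_r_coset_def')
qed

lemma homology_mcomp:
  "mcomp (homology D \<delta>) n = cls ` {x \<in> mcomp D n. x \<in> a_kernel D D \<delta>}"
  by (auto simp: homology_def quotient_gmodule_def cycles_def a_r_coset_def')

end

text \<open>A criterion on elements, which avoids working with cosets afterwards.\<close>

lemma quasi_isomorphismI:
  assumes D: "differential_module R D \<delta>" and D': "differential_module R D' \<delta>'"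
    and f: "f \<in> graded_hom R D D'" and chain: "\<And>x. x \<in> carrier D \<Longrightarrow> f (\<delta> x) = \<delta>' (f x)"
    and surj: "\<And>z. \<lbrakk>z \<in> carrier D'; \<delta>' z = \<zero>\<^bsub>D'\<^esub>\<rbrakk>
      \<Longrightarrow> \<exists>x\<in>carrier D. \<delta> x = \<zero>\<^bsub>D\<^esub> \<and> f x \<ominus>\<^bsub>D'\<^esub> z \<in> \<delta>' ` carrier D'"
    and inj: "\<And>x. \<lbrakk>x \<in> carrier D; \<delta> x = \<zero>\<^bsub>D\<^esub>; f x \<in> \<delta>' ` carrier D'\<rbrakk> \<Longrightarrow> x \<in> \<delta> ` carrier D"
  shows "quasi_isomorphism R D \<delta> D' \<delta>' f"
proof -
  interpret D: differential R D \<delta>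
    using D by (simp add: differential_module_iff)
  interpret D': differential R D' \<delta>'
    using D' by (simp add: differential_module_iff)
  interpret f: abelian_group_hom D D' f
    by (rule graded_hom_additive[OF D.graded_module_axioms D'.graded_module_axioms f])
  have boundary: "f x \<in> D'.boundaries" if "x \<in> D.boundaries" for x
    using that chain by auto
  have kernel: "f x \<in> a_kernel D' D' \<delta>'" if "x \<in> a_kernel D D \<delta>" for x
    using that chain[of x] by (simp add: D.kernel_iff D'.kernel_iff)
  have map: "homology_map D' \<delta>' f (D.cls x) = D'.cls (f x)" if x: "x \<in> carrier D" for x
  proof -
    have "D'.cls (f y) = D'.cls (f x)" if y: "y \<in> D.cls x" for y
    proof -
      have yD: "y \<in> carrier D"
        by (rule D.cls_closed[OF x y])
      have "f (y \<ominus>\<^bsub>D\<^esub> x) \<in> D'.boundaries"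
        using x y yD by (intro boundary) (simp flip: D.cls_mem)
      then show ?thesis
        using x yD by (simp add: D'.cls_eq f.hom_minus)
    qed
    then show ?thesis
      using D.B.a_rcos_self[OF x] unfolding homology_map_def by blast
  qed
  have "homology_map D' \<delta>' f \<in> graded_hom R (homology D \<delta>) (homology D' \<delta>')"
  proof (rule graded_homI)
    fix n X assume "X \<in> mcomp (homology D \<delta>) n"
    then obtain x where "x \<in> mcomp D n" "x \<in> a_kernel D D \<delta>" "X = D.cls x"
      by (auto simp: D.homology_mcomp)
    then show "homology_map D' \<delta>' f X \<in> mcomp (homology D' \<delta>') n"
      using kernel graded_hom_degree[OF f] by (auto simp: D'.homology_mcomp map D.kernel_iff)
  qed (auto simp: D.homology_carrier D'.homology_carrier D.kernel_iff map D.homology_add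
      D'.homology_add D.homology_smult D'.homology_smult graded_hom_smult[OF f] kernel)
  moreover have "bij_betw (homology_map D' \<delta>' f) (carrier (homology D \<delta>)) (carrier (homology D' \<delta>'))"
  proof (rule bij_betw_imageI)
    show "inj_on (homology_map D' \<delta>' f) (carrier (homology D \<delta>))"
    proof (rule inj_onI)
      fix X Y
      assume "X \<in> carrier (homology D \<delta>)" "Y \<in> carrier (homology D \<delta>)"
        and eq: "homology_map D' \<delta>' f X = homology_map D' \<delta>' f Y"
      then obtain x y where x: "x \<in> carrier D" "\<delta> x = \<zero>\<^bsub>D\<^esub>" "X = D.cls x"
        and y: "y \<in> carrier D" "\<delta> y = \<zero>\<^bsub>D\<^esub>" "Y = D.cls y"
        by (auto simp: D.homology_carrier D.kernel_iff)
      have "f (x \<ominus>\<^bsub>D\<^esub> y) \<in> D'.boundaries"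
        using eq x y by (simp add: map D'.cls_eq f.hom_minus)
      then have "x \<ominus>\<^bsub>D\<^esub> y \<in> D.boundaries"
        using x y by (intro inj) (simp_all add: D.d.hom_minus D.M.minus_eq)
      then show "X = Y"
        using x y by (simp add: D.cls_eq)
    qed
    show "homology_map D' \<delta>' f ` carrier (homology D \<delta>) = carrier (homology D' \<delta>')"
    proof (intro equalityI subsetI)
      fix Z assume "Z \<in> carrier (homology D' \<delta>')"
      then obtain z where z: "z \<in> carrier D'" "\<delta>' z = \<zero>\<^bsub>D'\<^esub>" "Z = D'.cls z"
        by (auto simp: D'.homology_carrier D'.kernel_iff)
      then obtain x where x: "x \<in> carrier D" "\<delta> x = \<zero>\<^bsub>D\<^esub>" "f x \<ominus>\<^bsub>D'\<^esub> z \<in> D'.boundaries"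
        using surj by blast
      then have "Z = homology_map D' \<delta>' f (D.cls x)"
        using z by (simp add: map D'.cls_eq[symmetric])
      then show "Z \<in> homology_map D' \<delta>' f ` carrier (homology D \<delta>)"
        using x by (auto simp: D.homology_carrier D.kernel_iff)
    qed (auto simp: D.homology_carrier D'.homology_carrier D.kernel_iff map kernel)
  qed
  ultimately show ?thesis
    using f chain by (simp add: quasi_isomorphism_def differential_morphism_def)
qed

section \<open>The flag over a resolution of the homology\<close>

locale homology_resolution = D: differential R D \<delta> + graded_family R F
  for R :: "'a gring" (structure) and D :: "('a, 'b) gmodule" and \<delta> :: "'b \<Rightarrow> 'b"
    and F :: "nat \<Rightarrow> ('a, 'c) gmodule" +
  fixes d :: "nat \<Rightarrow> 'c \<Rightarrow> 'c" and e :: "'c \<Rightarrow> 'b set"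
  assumes free: "graded_free R (F i)"
    and d_hom: "d i \<in> graded_hom R (F (Suc i)) (F i)"
    and e_hom: "e \<in> graded_hom R (F 0) (homology D \<delta>)"
    and e_surj: "e ` carrier (F 0) = carrier (homology D \<delta>)"
    and exact_0: "a_kernel (F 0) (homology D \<delta>) e = d 0 ` carrier (F 1)"
    and exact_Suc: "a_kernel (F (Suc i)) (F i) (d i) = d (Suc i) ` carrier (F (Suc (Suc i)))"
begin

lemma d_additive: "abelian_group_hom (F (Suc i)) (F i) (d i)"
  by (rule graded_hom_additive[OF summand_graded summand_graded d_hom])

lemma e_closed: "y \<in> carrier (F 0) \<Longrightarrow> \<exists>z\<in>carrier D. \<delta> z = \<zero>\<^bsub>D\<^esub> \<and> e y = D.cls z"
  using graded_hom_closed[OF e_hom, of y] unfolding D.homology_carrier by (auto simp: D.kernel_iff)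

lemma e_mem:
  assumes y: "y \<in> carrier (F 0)" and w: "w \<in> e y"
  shows "w \<in> carrier D" "\<delta> w = \<zero>\<^bsub>D\<^esub>" "e y = D.cls w"
proof -
  obtain z where z: "z \<in> carrier D" "\<delta> z = \<zero>\<^bsub>D\<^esub>" "e y = D.cls z"
    using e_closed[OF y] by blast
  show wD: "w \<in> carrier D"
    using D.cls_closed[of z w] z w by simp
  then have "w \<ominus>\<^bsub>D\<^esub> z \<in> D.boundaries"
    using w z by (simp add: D.cls_mem)
  then show "e y = D.cls w"
    using z wD D.cls_eq[of z w] by simp
  have "\<delta> (w \<ominus>\<^bsub>D\<^esub> z) = \<zero>\<^bsub>D\<^esub>"
    using D.boundary_kernel[OF \<open>w \<ominus>\<^bsub>D\<^esub> z \<in> D.boundaries\<close>] by (simp add: D.kernel_iff)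
  then show "\<delta> w = \<zero>\<^bsub>D\<^esub>"
    using wD z by (simp add: D.d.hom_minus D.M.minus_eq)
qed

text \<open>Homogeneous elements of degree n of the homology are classes of cycles of degree n, so the
  augmentation lifts through the projection from cycles to classes.\<close>

lemma exists_augmentation_lift: "\<exists>\<psi>\<in>graded_hom R (F 0) D. \<forall>x\<in>carrier (F 0). \<psi> x \<in> e x"
proof (rule graded_free_lift[OF free D.graded_module_axioms])
  fix n y
  assume y: "y \<in> mcomp (F 0) n"
  obtain z where "z \<in> mcomp D n" "e y = D.cls z"
    using graded_hom_degree[OF e_hom y] by (auto simp: D.homology_mcomp)
  then show "\<exists>z\<in>mcomp D n. z \<in> e y"
    using D.B.a_rcos_self[OF D.deg.summand_carrier] by blast
next
  have add: "z \<oplus>\<^bsub>D\<^esub> z' \<in> e (y \<oplus>\<^bsub>F 0\<^esub> y')"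
    if "y \<in> carrier (F 0)" "y' \<in> carrier (F 0)" "z \<in> e y" "z' \<in> e y'" for y y' z z'
  proof -
    have "e (y \<oplus>\<^bsub>F 0\<^esub> y') = e y \<oplus>\<^bsub>homology D \<delta>\<^esub> e y'"
      using e_hom that by (auto simp: graded_hom_def hom_def)
    then show ?thesis
      using that e_mem[of y z] e_mem[of y' z'] D.B.a_rcos_self by (simp add: D.homology_add)
  qed
  show smult: "a \<odot>\<^bsub>D\<^esub> z \<in> e (a \<odot>\<^bsub>F 0\<^esub> y)"
    if "a \<in> carrier R" "y \<in> carrier (F 0)" "z \<in> e y" for a y z
    using that e_mem[of y z] D.B.a_rcos_self
    by (simp add: graded_hom_smult[OF e_hom] D.homology_smult)
  obtain z where z: "z \<in> carrier D" "z \<in> e \<zero>\<^bsub>F 0\<^esub>"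
    using e_closed[of "\<zero>\<^bsub>F 0\<^esub>"] D.B.a_rcos_self by auto
  then show "\<zero>\<^bsub>D\<^esub> \<in> e \<zero>\<^bsub>F 0\<^esub>"
    using smult[of \<zero> "\<zero>\<^bsub>F 0\<^esub>" z] by simp
  show "z \<oplus>\<^bsub>D\<^esub> z' \<in> e (y \<oplus>\<^bsub>F 0\<^esub> y')"
    if "y \<in> carrier (F 0)" "z \<in> carrier D" "y' \<in> carrier (F 0)" "z' \<in> carrier D" "z \<in> e y" "z' \<in> e y'"
    for y z y' z'
    using add that by blast
qed

text \<open>Here \<open>\<Delta>\<close> and \<open>\<epsilon>\<close> are the maps constructed on the first k summands, and \<open>\<phi>\<close>, \<open>\<psi>\<close> are the
  restrictions to summand k of the differential and of the map to D. The values \<open>\<phi> x\<close> lie in the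
  first k summands, so the conditions do not depend on \<open>\<Delta>\<close> and \<open>\<epsilon>\<close> beyond those.\<close>

definition extends ::
    "nat \<Rightarrow> ((nat \<Rightarrow> 'c) \<Rightarrow> nat \<Rightarrow> 'c) \<Rightarrow> ((nat \<Rightarrow> 'c) \<Rightarrow> 'b) \<Rightarrow> ('c \<Rightarrow> nat \<Rightarrow> 'c) \<Rightarrow> ('c \<Rightarrow> 'b) \<Rightarrow> bool" where
  "extends k \<Delta> \<epsilon> \<phi> \<psi> \<longleftrightarrow>
     \<phi> \<in> graded_hom R (F k) S \<and> \<psi> \<in> graded_hom R (F k) D \<and>
     (\<forall>x\<in>carrier (F k). \<phi> x \<in> below k \<and> \<Delta> (\<phi> x) = \<zero>\<^bsub>S\<^esub> \<and> \<epsilon> (\<phi> x) = \<delta> (\<psi> x) \<and>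
        (\<forall>j. k = Suc j \<longrightarrow> \<phi> x j = d j x) \<and> (k = 0 \<longrightarrow> \<psi> x \<in> e x))"

text \<open>From summand k on the two maps are arbitrary graded maps; defining them on the whole direct sum
  spares the direct sum of the first k summands as a separate module.\<close>

definition partial_flag :: "nat \<Rightarrow> ((nat \<Rightarrow> 'c) \<Rightarrow> nat \<Rightarrow> 'c) \<Rightarrow> ((nat \<Rightarrow> 'c) \<Rightarrow> 'b) \<Rightarrow> bool" where
  "partial_flag k \<Delta> \<epsilon> \<longleftrightarrow> \<Delta> \<in> graded_hom R S S \<and> \<epsilon> \<in> graded_hom R S D \<and>
     (\<forall>i<k. extends i \<Delta> \<epsilon> (\<lambda>x. \<Delta> (incl i x)) (\<lambda>x. \<epsilon> (incl i x)))"

lemma below_subgroup: "additive_subgroup (below k) S"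
proof (rule additive_subgroupI, rule group.subgroupI[OF S.M.a_group])
  show "inv\<^bsub>add_monoid S\<^esub> x \<in> below k" if "x \<in> below k" for x
    using below_minus[OF below_zero that] that by (simp add: S.M.minus_eq flip: a_inv_def)
  show "below k \<noteq> {}"
    using below_zero by blast
qed (use below_add in auto)

context
  fixes k \<Delta> \<epsilon>
  assumes flag: "partial_flag k \<Delta> \<epsilon>"
begin

lemma \<Delta>_hom: "\<Delta> \<in> graded_hom R S S" and \<epsilon>_hom: "\<epsilon> \<in> graded_hom R S D"
  using flag by (simp_all add: partial_flag_def)

interpretation \<Delta>: abelian_group_hom S S \<Delta>
  by (rule graded_hom_additive[OF S_graded_module S_graded_module \<Delta>_hom])

interpretation \<epsilon>: abelian_group_hom S D \<epsilon>
  by (rule graded_hom_additive[OF S_graded_module D.graded_module_axioms \<epsilon>_hom])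

lemma flag_incl:
  assumes "i < k" "x \<in> carrier (F i)"
  shows "\<Delta> (incl i x) \<in> below i" "\<Delta> (\<Delta> (incl i x)) = \<zero>\<^bsub>S\<^esub>" "\<epsilon> (\<Delta> (incl i x)) = \<delta> (\<epsilon> (incl i x))"
    "i = Suc j \<Longrightarrow> \<Delta> (incl i x) j = d j x" "i = 0 \<Longrightarrow> \<epsilon> (incl i x) \<in> e x"
  using flag assms by (auto simp: partial_flag_def extends_def)

lemma flag_below:
  assumes "x \<in> below (Suc m)" "m < k"
  shows "\<Delta> x \<in> below m"
  by (rule below_hom_closed[OF assms(1) below_subgroup \<Delta>.abelian_group_hom_axioms])
    (use assms(2) flag_incl(1) below_mono in \<open>metis less_Suc_eq_le less_le_trans not_less\<close>)

lemma flag_square: "x \<in> below k \<Longrightarrow> \<Delta> (\<Delta> x) = \<zero>\<^bsub>S\<^esub>"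
  by (induction rule: below_induct) (simp_all add: flag_incl(2))

lemma flag_chain: "x \<in> below k \<Longrightarrow> \<epsilon> (\<Delta> x) = \<delta> (\<epsilon> x)"
  by (induction rule: below_induct) (simp_all add: flag_incl(3))

text \<open>By triangularity the lower summands do not contribute to the coordinate j of \<open>\<Delta> x\<close>.\<close>

lemma flag_top:
  assumes x: "x \<in> below (Suc (Suc j))" and j: "Suc j < k"
  shows "\<Delta> x j = d j (x (Suc j))"
proof -
  let ?t = "incl (Suc j) (x (Suc j))"
  have t: "x \<in> carrier S" "?t \<in> carrier S"
    using x by auto
  have rest: "\<Delta> (x \<ominus>\<^bsub>S\<^esub> ?t) \<in> below j"
    using flag_below[OF below_top[OF x]] j by simp
  have split: "(x \<ominus>\<^bsub>S\<^esub> ?t) \<oplus>\<^bsub>S\<^esub> ?t = x"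
    using t by (simp add: S.M.minus_eq S.M.a_assoc S.M.l_neg)
  have "\<Delta> ((x \<ominus>\<^bsub>S\<^esub> ?t) \<oplus>\<^bsub>S\<^esub> ?t) = \<Delta> (x \<ominus>\<^bsub>S\<^esub> ?t) \<oplus>\<^bsub>S\<^esub> \<Delta> ?t"
    using t by (intro \<Delta>.hom_add) auto
  then have "\<Delta> x j = \<Delta> ?t j"
    unfolding split using rest t by (simp add: direct_sum_apply)
  then show ?thesis
    using flag_incl(4)[OF j, of "x (Suc j)" j] t by simp
qed

lemma flag_augmentation:
  assumes x: "x \<in> below 1" and k: "0 < k"
  shows "\<epsilon> x \<in> e (x 0)"
proof -
  have "incl 0 (x 0) = x"
    using below_apply[OF x] by (auto simp: incl_apply fun_eq_iff)
  then show ?thesis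
    using flag_incl(5)[OF k, of "x 0"] x by simp
qed

text \<open>The coordinates of w are eliminated from the top. The top coordinate of w is a cycle of the resolution: if it sits in a positive
  summand this is the top coordinate of \<open>\<Delta> w = 0\<close>, and in summand 0 it says that \<open>\<epsilon> w\<close> has trivial
  class. By exactness the top coordinate is then \<open>d v\<close>, and subtracting the boundary of v leaves a
  cycle of the same kind with one coordinate less. This is used both to extend a partial flag and,
  for the complete flag, to prove injectivity on homology.\<close>

lemma flag_exact:
  assumes "w \<in> below m" "m < k" "\<Delta> w = \<zero>\<^bsub>S\<^esub>" "\<epsilon> w \<in> D.boundaries"
  shows "\<exists>u\<in>below (Suc m). \<Delta> u = w"
  using assms
proof (induction m arbitrary: w)
  case 0
  then show ?case
    by (intro bexI[of _ "\<zero>\<^bsub>S\<^esub>"]) (auto simp: below_0)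
next
  case (Suc m)
  have w: "w \<in> carrier S"
    using Suc.prems by auto
  have "\<exists>v\<in>carrier (F (Suc m)). d m v = w m"
  proof (cases m)
    case 0
    have "\<epsilon> w \<in> e (w 0)"
      using Suc.prems 0 by (intro flag_augmentation) auto
    then have "e (w 0) = D.cls (\<epsilon> w)"
      using w by (intro e_mem) auto
    then have "w 0 \<in> a_kernel (F 0) (homology D \<delta>) e"
      using Suc.prems(4) w by (simp add: a_kernel_def' D.homology_zero D.B.a_rcos_const)
    then show ?thesis
      using exact_0 0 by auto
  next
    case (Suc q)
    have "d q (w (Suc q)) = \<zero>\<^bsub>F q\<^esub>"
      using flag_top[of w q] Suc.prems Suc by (simp add: direct_sum_apply)
    then have "w (Suc q) \<in> a_kernel (F (Suc q)) (F q) (d q)"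
      using w by (simp add: a_kernel_def')
    then show ?thesis
      using exact_Suc Suc by auto
  qed
  then obtain v where v: "v \<in> carrier (F (Suc m))" "d m v = w m"
    by blast
  let ?w' = "w \<ominus>\<^bsub>S\<^esub> \<Delta> (incl (Suc m) v)"
  have v_below: "incl (Suc m) v \<in> below (Suc (Suc m))" "incl (Suc m) v \<in> below k"
    using v Suc.prems(2) by (auto intro: incl_below)
  have "?w' \<in> below m"
  proof (rule below_Suc)
    show "?w' \<in> below (Suc m)"
      using Suc.prems v by (intro below_minus flag_incl(1))
    have "\<Delta> (incl (Suc m) v) m = w m"
      using flag_incl(4)[OF Suc.prems(2) v(1)] v by simp
    then show "?w' m = \<zero>\<^bsub>F m\<^esub>"
      using w v by (simp add: S_minus_apply F.M.minus_eq F.M.r_neg)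
  qed
  moreover have "\<Delta> ?w' = \<zero>\<^bsub>S\<^esub>"
    using w v Suc.prems by (simp add: \<Delta>.hom_minus flag_incl(2) S.M.minus_eq)
  moreover have "\<epsilon> ?w' \<in> D.boundaries"
  proof -
    have "\<epsilon> ?w' = \<epsilon> w \<oplus>\<^bsub>D\<^esub> \<ominus>\<^bsub>D\<^esub> (\<delta> (\<epsilon> (incl (Suc m) v)))"
      using w v Suc.prems(2) by (simp add: \<epsilon>.hom_minus flag_incl(3) D.M.minus_eq)
    then show ?thesis
      using Suc.prems(4) v D.B.a_closed D.B.a_inv_closed by simp
  qed
  ultimately obtain u where u: "u \<in> below (Suc m)" "\<Delta> u = ?w'"
    using Suc.IH Suc.prems(2) by (meson Suc_lessD)
  have "u \<oplus>\<^bsub>S\<^esub> incl (Suc m) v \<in> below (Suc (Suc m))"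
    using u(1) v_below by (intro below_add) (auto intro: below_mono)
  moreover have "\<Delta> (u \<oplus>\<^bsub>S\<^esub> incl (Suc m) v) = w"
    using u v w by (simp add: S.M.minus_eq S.M.a_assoc S.M.l_neg)
  ultimately show ?case
    by blast
qed

lemma flag_surjective:
  assumes "z \<in> carrier D" "\<delta> z = \<zero>\<^bsub>D\<^esub>" "0 < k"
  obtains f where "f \<in> carrier (F 0)" "\<epsilon> (incl 0 f) \<ominus>\<^bsub>D\<^esub> z \<in> D.boundaries"
proof -
  have "D.cls z \<in> e ` carrier (F 0)"
    using assms by (auto simp: e_surj D.homology_carrier D.kernel_iff)
  then obtain f where f: "f \<in> carrier (F 0)" "e f = D.cls z"
    by auto
  then have "\<epsilon> (incl 0 f) \<in> D.cls z"
    using flag_incl(5)[OF assms(3) f(1)] by simp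
  then show ?thesis
    using that f assms by (simp add: D.cls_mem)
qed

text \<open>The heart of the construction. The boundary of y in the flag has no component in summand q,
  where \<open>p = Suc q\<close>, since \<open>d y = 0\<close>. So it lies in lower summands, it is a cycle, and \<open>\<epsilon>\<close> maps it to the
  boundary \<open>\<delta> (\<epsilon> y)\<close>. By \<open>flag_exact\<close> it equals \<open>\<Delta> u\<close> with u below p, and \<open>y - u\<close> is a cycle. Its image
  in D may have a nontrivial class, but every class comes from summand 0, where all elements are
  cycles; a second correction by such an element removes it. For \<open>p = 0\<close> no correction is called for.\<close>

lemma flag_lift_cycle:
  assumes k: "k = Suc p" and y: "y \<in> carrier (F p)"
    and y_Suc: "\<And>q. p = Suc q \<Longrightarrow> d q y = \<zero>\<^bsub>F q\<^esub>" and y_0: "p = 0 \<Longrightarrow> e y = D.boundaries"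
  shows "\<exists>z\<in>below k. z p = y \<and> \<Delta> z = \<zero>\<^bsub>S\<^esub> \<and> \<epsilon> z \<in> D.boundaries"
proof (cases p)
  case 0
  have "\<Delta> (incl 0 y) = \<zero>\<^bsub>S\<^esub>"
    using flag_incl(1)[of 0 y] k y 0 by (simp add: below_0)
  moreover have "\<epsilon> (incl 0 y) \<in> D.boundaries"
    using flag_incl(5)[of 0 y] k y 0 y_0 by simp
  ultimately show ?thesis
    using y k 0 by (intro bexI[of _ "incl 0 y"]) (auto simp: incl_apply intro: incl_below)
next
  case (Suc q)
  let ?y = "incl p y"
  have yS: "?y \<in> carrier S" and pk: "p < k"
    using y k by auto
  have "\<Delta> ?y q = \<zero>\<^bsub>F q\<^esub>"
    using flag_incl(4)[OF pk y Suc] y_Suc[OF Suc] by simp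
  then have "\<Delta> ?y \<in> below q"
    by (rule below_Suc[rotated]) (use flag_incl(1)[OF pk y] Suc in simp)
  moreover have "\<epsilon> (\<Delta> ?y) \<in> D.boundaries"
    using flag_incl(3)[OF pk y] yS by simp
  ultimately obtain u where u: "u \<in> below p" "\<Delta> u = \<Delta> ?y"
    using flag_exact[of "\<Delta> ?y" q] flag_incl(2)[OF pk y] pk Suc by auto
  let ?z = "?y \<ominus>\<^bsub>S\<^esub> u"
  have z: "?z \<in> below k"
    using u y k by (intro below_minus incl_below) (auto intro: below_mono)
  have \<Delta>z: "\<Delta> ?z = \<zero>\<^bsub>S\<^esub>"
    using u yS by (simp add: \<Delta>.hom_minus S.M.minus_eq S.M.r_neg)
  have "\<delta> (\<epsilon> ?z) = \<zero>\<^bsub>D\<^esub>"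
    using flag_chain[OF z] \<Delta>z by simp
  then obtain f where f: "f \<in> carrier (F 0)" "\<epsilon> (incl 0 f) \<ominus>\<^bsub>D\<^esub> \<epsilon> ?z \<in> D.boundaries"
    using flag_surjective[of "\<epsilon> ?z"] z k by (metis \<epsilon>.hom_closed below_closed zero_less_Suc)
  have \<Delta>f: "\<Delta> (incl 0 f) = \<zero>\<^bsub>S\<^esub>"
    using flag_incl(1)[of 0 f] k f by (simp add: below_0)
  let ?z' = "?z \<ominus>\<^bsub>S\<^esub> incl 0 f"
  have zS: "?z \<in> carrier S" "incl 0 f \<in> carrier S"
    using z f by auto
  have "?z' \<in> below k"
    by (rule below_minus[OF z incl_below]) (use f k in auto)
  moreover have "?z' p = y"
    using zS yS u f y Suc by (simp add: S_minus_apply incl_apply F.M.minus_eq)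
  moreover have "\<Delta> ?z' = \<zero>\<^bsub>S\<^esub>"
    using zS \<Delta>z \<Delta>f by (simp add: \<Delta>.hom_minus S.M.minus_eq)
  moreover have "\<epsilon> ?z' \<in> D.boundaries"
  proof -
    have "\<epsilon> ?z' = \<ominus>\<^bsub>D\<^esub> (\<epsilon> (incl 0 f) \<ominus>\<^bsub>D\<^esub> \<epsilon> ?z)"
      using zS by (simp add: \<epsilon>.hom_minus D.M.minus_eq D.M.minus_add D.M.a_comm)
    then show ?thesis
      using D.B.a_inv_closed[OF f(2)] by simp
  qed
  ultimately show ?thesis
    by blast
qed

end

subsection \<open>Extending a partial flag by one summand\<close>

text \<open>Two lifting problems are solved in succession. The image of \<open>d p\<close> consists of cycles of the
  resolution, which lift to cycles z of the flag by \<open>flag_lift_cycle\<close>; this gives \<open>\<phi>\<close>. Since \<open>\<epsilon>\<close> maps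
  these cycles to boundaries, \<open>\<psi>\<close> is then a lift through \<open>\<delta>\<close>.\<close>

lemma partial_flag_extends:
  assumes flag: "partial_flag k \<Delta> \<epsilon>"
  shows "\<exists>\<phi> \<psi>. extends k \<Delta> \<epsilon> \<phi> \<psi>"
proof -
  have \<Delta>_hom: "\<Delta> \<in> graded_hom R S S" and \<epsilon>_hom: "\<epsilon> \<in> graded_hom R S D"
    using flag by (simp_all add: partial_flag_def)
  interpret \<Delta>: abelian_group_hom S S \<Delta>
    by (rule graded_hom_additive[OF S_graded_module S_graded_module \<Delta>_hom])
  interpret \<epsilon>: abelian_group_hom S D \<epsilon>
    by (rule graded_hom_additive[OF S_graded_module D.graded_module_axioms \<epsilon>_hom])
  show ?thesis
  proof (cases k)
    case 0
    obtain \<psi> where \<psi>: "\<psi> \<in> graded_hom R (F 0) D" "\<And>x. x \<in> carrier (F 0) \<Longrightarrow> \<psi> x \<in> e x"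
      using exists_augmentation_lift by blast
    have "extends k \<Delta> \<epsilon> (\<lambda>x. \<zero>\<^bsub>S\<^esub>) \<psi>"
      using \<psi> e_mem(2)[OF _ \<psi>(2)] zero_graded_hom[OF S_graded_module, of "F 0"]
      by (simp add: extends_def 0)
    then show ?thesis
      by blast
  next
    case (Suc p)
    interpret dp: abelian_group_hom "F k" "F p" "d p"
      unfolding Suc by (rule d_additive)
    have dp_hom: "d p \<in> graded_hom R (F k) (F p)"
      unfolding Suc by (rule d_hom)
    have d_cycle: "d q (d p x) = \<zero>\<^bsub>F q\<^esub>" if "x \<in> carrier (F k)" "p = Suc q" for x q
      using exact_Suc[of q] that Suc by (auto simp: a_kernel_def')
    have e_cycle: "e (d p x) = D.boundaries" if "x \<in> carrier (F k)" "p = 0" for x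
      using exact_0 that Suc by (auto simp: a_kernel_def' D.homology_zero)
    have "\<exists>\<phi>\<in>graded_hom R (F k) S. \<forall>x\<in>carrier (F k).
        \<phi> x \<in> below k \<and> \<phi> x p = d p x \<and> \<Delta> (\<phi> x) = \<zero>\<^bsub>S\<^esub> \<and> \<epsilon> (\<phi> x) \<in> D.boundaries"
    proof (rule graded_free_lift[OF free S_graded_module])
      fix n x
      assume x: "x \<in> mcomp (F k) n"
      then have xF: "x \<in> carrier (F k)"
        by (rule F.deg.summand_carrier)
      obtain z where z: "z \<in> below k" "z p = d p x" "\<Delta> z = \<zero>\<^bsub>S\<^esub>" "\<epsilon> z \<in> D.boundaries"
        using flag_lift_cycle[OF flag Suc, of "d p x"] d_cycle[OF xF] e_cycle[OF xF] xF by auto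
      have zS: "z \<in> carrier S"
        using z by simp
      \<comment> \<open>The cycle found need not be homogeneous. Its component of degree n still has all
         properties, since each of them is expressed by maps that preserve degrees.\<close>
      let ?z = "component S (mcomp S) n z"
      have apply_z: "?z j = component (F j) (mcomp (F j)) n (z j)" for j
        using graded_hom_component[OF S_graded_module summand_graded proj_graded_hom zS] by simp
      have in_S: "?z \<in> mcomp S n"
        by (rule S.deg.component_in[OF zS])
      show "\<exists>z\<in>mcomp S n. z \<in> below k \<and> z p = d p x \<and> \<Delta> z = \<zero>\<^bsub>S\<^esub> \<and> \<epsilon> z \<in> D.boundaries"
      proof (intro bexI[of _ ?z] conjI in_S)
        show "?z \<in> below k"
          using z(1) S.deg.summand_carrier[OF in_S]
          by (intro belowI) (simp_all add: apply_z abelian_group_hom.hom_zero[OF F.deg.component_hom])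
        show "?z p = d p x"
          using F.deg.component_homogeneous[OF graded_hom_degree[OF dp_hom x], of n]
          by (simp add: apply_z z(2))
        show "\<Delta> ?z = \<zero>\<^bsub>S\<^esub>"
          using graded_hom_component[OF S_graded_module S_graded_module \<Delta>_hom zS, of n] z(3)
          by (simp add: abelian_group_hom.hom_zero[OF S.deg.component_hom])
        obtain w where w: "w \<in> carrier D" "\<epsilon> z = \<delta> w"
          using z(4) by blast
        have "\<epsilon> ?z = \<delta> (component D (mcomp D) n w)"
          using graded_hom_component[OF S_graded_module D.graded_module_axioms \<epsilon>_hom zS, of n]
            graded_hom_component[OF D.graded_module_axioms D.graded_module_axioms D.diff_graded_hom w(1), of n]
          by (simp add: w(2))
        then show "\<epsilon> ?z \<in> D.boundaries"
          using D.deg.summand_carrier[OF D.deg.component_in[OF w(1)]] by blast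
      qed
    next
      show "\<zero>\<^bsub>S\<^esub> \<in> below k \<and> \<zero>\<^bsub>S\<^esub> p = d p \<zero>\<^bsub>F k\<^esub> \<and> \<Delta> \<zero>\<^bsub>S\<^esub> = \<zero>\<^bsub>S\<^esub> \<and> \<epsilon> \<zero>\<^bsub>S\<^esub> \<in> D.boundaries"
        by (simp add: direct_sum_apply[where i = p] D.B.zero_closed del: image_iff)
    next
      fix y z y' z'
      assume "y \<in> carrier (F k)" "y' \<in> carrier (F k)" "z \<in> carrier S" "z' \<in> carrier S"
        and "z \<in> below k \<and> z p = d p y \<and> \<Delta> z = \<zero>\<^bsub>S\<^esub> \<and> \<epsilon> z \<in> D.boundaries"
        and "z' \<in> below k \<and> z' p = d p y' \<and> \<Delta> z' = \<zero>\<^bsub>S\<^esub> \<and> \<epsilon> z' \<in> D.boundaries"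
      then show "z \<oplus>\<^bsub>S\<^esub> z' \<in> below k \<and> (z \<oplus>\<^bsub>S\<^esub> z') p = d p (y \<oplus>\<^bsub>F k\<^esub> y') \<and>
          \<Delta> (z \<oplus>\<^bsub>S\<^esub> z') = \<zero>\<^bsub>S\<^esub> \<and> \<epsilon> (z \<oplus>\<^bsub>S\<^esub> z') \<in> D.boundaries"
        by (simp add: direct_sum_apply[where i = p] below_add D.B.a_closed del: image_iff)
    next
      fix a y z
      assume "a \<in> carrier R" "y \<in> carrier (F k)" "z \<in> carrier S"
        and "z \<in> below k \<and> z p = d p y \<and> \<Delta> z = \<zero>\<^bsub>S\<^esub> \<and> \<epsilon> z \<in> D.boundaries"
      then show "a \<odot>\<^bsub>S\<^esub> z \<in> below k \<and> (a \<odot>\<^bsub>S\<^esub> z) p = d p (a \<odot>\<^bsub>F k\<^esub> y) \<and>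
          \<Delta> (a \<odot>\<^bsub>S\<^esub> z) = \<zero>\<^bsub>S\<^esub> \<and> \<epsilon> (a \<odot>\<^bsub>S\<^esub> z) \<in> D.boundaries"
        by (simp add: direct_sum_apply[where i = p] below_smult D.boundary_smult graded_hom_smult[OF dp_hom]
            graded_hom_smult[OF \<Delta>_hom] graded_hom_smult[OF \<epsilon>_hom] del: image_iff)
    qed
    then obtain \<phi> where \<phi>: "\<phi> \<in> graded_hom R (F k) S" "\<And>x. x \<in> carrier (F k) \<Longrightarrow>
        \<phi> x \<in> below k \<and> \<phi> x p = d p x \<and> \<Delta> (\<phi> x) = \<zero>\<^bsub>S\<^esub> \<and> \<epsilon> (\<phi> x) \<in> D.boundaries"
      by blast
    interpret \<phi>: abelian_group_hom "F k" S \<phi>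
      by (rule graded_hom_additive[OF summand_graded S_graded_module \<phi>(1)])
    have "\<exists>\<psi>\<in>graded_hom R (F k) D. \<forall>x\<in>carrier (F k). \<epsilon> (\<phi> x) = \<delta> (\<psi> x)"
    proof (rule graded_free_lift[OF free D.graded_module_axioms])
      fix n x
      assume x: "x \<in> mcomp (F k) n"
      then obtain w where w: "w \<in> carrier D" "\<epsilon> (\<phi> x) = \<delta> w"
        using \<phi>(2) F.deg.summand_carrier by blast
      have "\<epsilon> (\<phi> x) = component D (mcomp D) n (\<epsilon> (\<phi> x))"
        using D.deg.component_homogeneous[OF graded_hom_degree[OF \<epsilon>_hom graded_hom_degree[OF \<phi>(1) x]], of n]
        by simp
      also have "\<dots> = \<delta> (component D (mcomp D) n w)"
        unfolding w(2)
        by (rule graded_hom_component[OF D.graded_module_axioms D.graded_module_axioms D.diff_graded_hom w(1)])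
      finally show "\<exists>w\<in>mcomp D n. \<epsilon> (\<phi> x) = \<delta> w"
        using D.deg.component_in[OF w(1)] by blast
    qed (simp_all add: graded_hom_smult[OF \<phi>(1)] graded_hom_smult[OF \<epsilon>_hom] graded_hom_smult[OF D.diff_graded_hom])
    then obtain \<psi> where "\<psi> \<in> graded_hom R (F k) D" "\<And>x. x \<in> carrier (F k) \<Longrightarrow> \<epsilon> (\<phi> x) = \<delta> (\<psi> x)"
      by blast
    then have "extends k \<Delta> \<epsilon> \<phi> \<psi>"
      using \<phi> Suc by (simp add: extends_def)
    then show ?thesis
      by blast
  qed
qed

subsection \<open>The complete flag\<close>

text \<open>Members of a family that have not been chosen yet are arbitrary functions. They are replaced
  by zero, so that the family consists of graded maps and depends only on the choices made.\<close>

definition truncate :: "nat \<Rightarrow> ('a, 'd) gmodule \<Rightarrow> (nat \<Rightarrow> 'c \<Rightarrow> 'd) \<Rightarrow> nat \<Rightarrow> 'c \<Rightarrow> 'd" where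
  "truncate k N f i = (if i < k then f i else (\<lambda>x. \<zero>\<^bsub>N\<^esub>))"

lemma truncate_hom:
  assumes "graded_module R N" "\<And>i. i < k \<Longrightarrow> f i \<in> graded_hom R (F i) N"
  shows "truncate k N f i \<in> graded_hom R (F i) N"
  using assms zero_graded_hom[OF assms(1), of "F i"] by (simp add: truncate_def)

lemma truncate_cong: "(\<And>i. i < k \<Longrightarrow> f i = g i) \<Longrightarrow> truncate k N f = truncate k N g"
  by (auto simp: truncate_def fun_eq_iff)

lemma copair_partial_flag:
  assumes f: "\<And>i. f i \<in> graded_hom R (F i) S" and g: "\<And>i. g i \<in> graded_hom R (F i) D"
    and ext: "\<And>i. i < k \<Longrightarrow> extends i (copair S (truncate i S f)) (copair D (truncate i D g)) (f i) (g i)"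
  shows "partial_flag k (copair S f) (copair D g)"
  unfolding partial_flag_def
proof (intro conjI allI impI copair_graded_hom S_graded_module D.graded_module_axioms f g)
  fix i assume i: "i < k"
  note incl_f = copair_incl[OF S_graded_module f] and incl_g = copair_incl[OF D.graded_module_axioms g]
  have cong_f: "copair S (truncate i S f) x = copair S f x" if "x \<in> below i" for x
    using that by (rule copair_cong[OF S_graded_module f]) (simp add: truncate_def)
  have cong_g: "copair D (truncate i D g) x = copair D g x" if "x \<in> below i" for x
    using that by (rule copair_cong[OF D.graded_module_axioms g]) (simp add: truncate_def)
  have "(\<lambda>x. copair S f (incl i x)) \<in> graded_hom R (F i) S"
    "(\<lambda>x. copair D g (incl i x)) \<in> graded_hom R (F i) D"
    by (rule graded_hom_compose[OF incl_graded_hom copair_graded_hom[OF S_graded_module f]],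
        rule graded_hom_compose[OF incl_graded_hom copair_graded_hom[OF D.graded_module_axioms g]])
  moreover have "copair S f (incl i x) \<in> below i \<and> copair S f (copair S f (incl i x)) = \<zero>\<^bsub>S\<^esub> \<and>
      copair D g (copair S f (incl i x)) = \<delta> (copair D g (incl i x)) \<and>
      (\<forall>j. i = Suc j \<longrightarrow> copair S f (incl i x) j = d j x) \<and> (i = 0 \<longrightarrow> copair D g (incl i x) \<in> e x)"
    if x: "x \<in> carrier (F i)" for x
  proof -
    note ext_x = ext[OF i, unfolded extends_def, THEN conjunct2, THEN conjunct2, THEN bspec, OF x]
    show ?thesis
      unfolding incl_f[OF x] incl_g[OF x]
      using ext_x cong_f[of "f i x"] cong_g[of "f i x"] by simp
  qed
  ultimately show "extends i (copair S f) (copair D g) (\<lambda>x. copair S f (incl i x)) (\<lambda>x. copair D g (incl i x))"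
    unfolding extends_def by blast
qed

text \<open>The pairs \<open>(\<phi>, \<psi>)\<close> are chosen by dependent choice along the summands. The condition on the
  pair for summand k mentions the earlier ones only through the truncated families, and once all
  are chosen the truncations agree with the full families where they are evaluated.\<close>

lemma exists_flag: "\<exists>\<Delta> \<epsilon>. \<forall>k. partial_flag k \<Delta> \<epsilon>"
proof -
  define P where "P s k r \<longleftrightarrow> extends k (copair S (truncate k S (\<lambda>i. fst (s i))))
      (copair D (truncate k D (\<lambda>i. snd (s i)))) (fst r) (snd r)"
    for s :: "nat \<Rightarrow> ('c \<Rightarrow> nat \<Rightarrow> 'c) \<times> ('c \<Rightarrow> 'b)" and k r
  have hom: "fst r \<in> graded_hom R (F k) S" "snd r \<in> graded_hom R (F k) D" if "P s k r" for s k r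
    using that by (simp_all add: P_def extends_def)
  have "\<exists>s. \<forall>k. P s k (s k)"
  proof (rule dependent_wellorder_choice)
    fix r k and s t :: "nat \<Rightarrow> ('c \<Rightarrow> nat \<Rightarrow> 'c) \<times> ('c \<Rightarrow> 'b)"
    assume "\<And>i. i < k \<Longrightarrow> s i = t i"
    then have "truncate k S (\<lambda>i. fst (s i)) = truncate k S (\<lambda>i. fst (t i))"
      "truncate k D (\<lambda>i. snd (s i)) = truncate k D (\<lambda>i. snd (t i))"
      by (auto intro!: truncate_cong)
    then show "P s k r = P t k r"
      by (simp add: P_def)
  next
    fix k s
    assume IH: "\<And>i. i < k \<Longrightarrow> P s i (s i)"
    let ?f = "truncate k S (\<lambda>i. fst (s i))" and ?g = "truncate k D (\<lambda>i. snd (s i))"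
    have "partial_flag k (copair S ?f) (copair D ?g)"
    proof (rule copair_partial_flag)
      fix i assume i: "i < k"
      have "truncate i S ?f = truncate i S (\<lambda>i. fst (s i))" "truncate i D ?g = truncate i D (\<lambda>i. snd (s i))"
        using i by (auto intro!: truncate_cong simp: truncate_def)
      then show "extends i (copair S (truncate i S ?f)) (copair D (truncate i D ?g)) (?f i) (?g i)"
        using IH[OF i] i by (simp add: P_def truncate_def[of k])
    qed (use hom[OF IH] in \<open>auto intro!: truncate_hom S_graded_module D.graded_module_axioms\<close>)
    then obtain \<phi> \<psi> where "extends k (copair S ?f) (copair D ?g) \<phi> \<psi>"
      using partial_flag_extends by blast
    then have "P s k (\<phi>, \<psi>)"
      by (simp add: P_def)
    then show "\<exists>r. P s k r"
      by blast
  qed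
  then obtain s where s: "\<And>k. P s k (s k)"
    by blast
  have "partial_flag k (copair S (\<lambda>i. fst (s i))) (copair D (\<lambda>i. snd (s i)))" for k
    using s hom[OF s] by (intro copair_partial_flag) (auto simp: P_def)
  then show ?thesis
    by blast
qed

lemma exists_free_flag_resolution:
  "\<exists>\<Delta> \<epsilon>. free_flag_resolution R F \<Delta> D \<delta> \<epsilon> \<and>
    (\<forall>i j. j \<ge> i \<longrightarrow> (\<forall>x \<in> carrier (F i). block F \<Delta> i j x = \<zero>\<^bsub>F j\<^esub>)) \<and>
    (\<forall>j. \<forall>x \<in> carrier (F (Suc j)). block F \<Delta> (Suc j) j x = d j x) \<and>
    (\<forall>i j. block F \<Delta> i j \<in> graded_hom R (F i) (F j))"
proof -
  obtain \<Delta> \<epsilon> where flag: "\<And>k. partial_flag k \<Delta> \<epsilon>"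
    using exists_flag by blast
  have \<Delta>_hom: "\<Delta> \<in> graded_hom R S S" and \<epsilon>_hom: "\<epsilon> \<in> graded_hom R S D"
    using flag by (simp_all add: partial_flag_def)
  have below: "\<Delta> (incl i x) \<in> below i" if "x \<in> carrier (F i)" for i x
    by (rule flag_incl(1)[OF flag lessI that])
  have diff: "differential_module R S \<Delta>"
    unfolding differential_module_def
  proof (intro conjI ballI S_graded_module \<Delta>_hom)
    fix x assume "x \<in> carrier S"
    then obtain k where "x \<in> below k"
      by (rule below_exhaust)
    then show "\<Delta> (\<Delta> x) = \<zero>\<^bsub>S\<^esub>"
      by (rule flag_square[OF flag])
  qed
  have chain: "\<epsilon> (\<Delta> x) = \<delta> (\<epsilon> x)" if x: "x \<in> carrier S" for x
  proof -
    obtain k where "x \<in> below k"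
      using x by (rule below_exhaust)
    then show ?thesis
      by (rule flag_chain[OF flag])
  qed
  have "free_flag R F \<Delta>"
    unfolding free_flag_def
    by (intro conjI allI ballI diff free below[unfolded below_def])
  moreover have "quasi_isomorphism R S \<Delta> D \<delta> \<epsilon>"
  proof (rule quasi_isomorphismI[OF diff _ \<epsilon>_hom])
    show "\<epsilon> (\<Delta> x) = \<delta> (\<epsilon> x)" if "x \<in> carrier S" for x
      by (rule chain[OF that])
    show "differential_module R D \<delta>"
      unfolding differential_module_iff by (rule D.differential_axioms)
    fix z assume "z \<in> carrier D" "\<delta> z = \<zero>\<^bsub>D\<^esub>"
    then obtain f where f: "f \<in> carrier (F 0)" "\<epsilon> (incl 0 f) \<ominus>\<^bsub>D\<^esub> z \<in> D.boundaries"
      by (rule flag_surjective[OF flag _ _ zero_less_one])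
    then show "\<exists>x\<in>carrier S. \<Delta> x = \<zero>\<^bsub>S\<^esub> \<and> \<epsilon> x \<ominus>\<^bsub>D\<^esub> z \<in> D.boundaries"
      using below[OF f(1)] by (intro bexI[of _ "incl 0 f"]) (auto simp: below_0)
  next
    fix x assume x: "x \<in> carrier S" "\<Delta> x = \<zero>\<^bsub>S\<^esub>" "\<epsilon> x \<in> D.boundaries"
    obtain k where "x \<in> below k"
      using x(1) by (rule below_exhaust)
    then obtain u where "u \<in> below (Suc k)" "\<Delta> u = x"
      using flag_exact[OF flag _ lessI x(2,3)] by blast
    then show "x \<in> \<Delta> ` carrier S"
      by auto
  qed
  moreover have "block F \<Delta> i j \<in> graded_hom R (F i) (F j)" for i j
  proof -
    have "(\<lambda>x. \<Delta> (incl i x) j) \<in> graded_hom R (F i) (F j)"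
      by (rule graded_hom_compose[OF graded_hom_compose[OF incl_graded_hom \<Delta>_hom] proj_graded_hom])
    then show ?thesis
      by (simp add: block_def)
  qed
  moreover have "block F \<Delta> i j x = \<zero>\<^bsub>F j\<^esub>" if "i \<le> j" "x \<in> carrier (F i)" for i j x
    using below[OF that(2)] that(1) by (simp add: block_def)
  moreover have "block F \<Delta> (Suc j) j x = d j x" if "x \<in> carrier (F (Suc j))" for j x
    unfolding block_def by (rule flag_incl(4)[OF flag lessI that refl])
  ultimately show ?thesis
    unfolding free_flag_resolution_def by blast
qed

end

theorem theorem1p4:
  fixes R :: "'a gring"
    and D :: "('a, 'b) gmodule" and \<delta> :: "'b \<Rightarrow> 'b"
    and F :: "nat \<Rightarrow> ('a, 'c) gmodule" and d :: "nat \<Rightarrow> 'c \<Rightarrow> 'c" and e :: "'c \<Rightarrow> 'b set"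
  assumes "graded_local_ring R"
    and "differential_module R D \<delta>"
    and "finitely_generated R (homology D \<delta>)"
    and "minimal_free_resolution R F d e (homology D \<delta>)"
  shows "\<exists>\<Delta> \<epsilon>. free_flag_resolution R F \<Delta> D \<delta> \<epsilon> \<and>
    (\<forall>i j. j \<ge> i \<longrightarrow> (\<forall>x \<in> carrier (F i). block F \<Delta> i j x = \<zero>\<^bsub>F j\<^esub>)) \<and>
    (\<forall>j. \<forall>x \<in> carrier (F (Suc j)). block F \<Delta> (Suc j) j x = d j x) \<and>
    (\<forall>i j. j + 1 < i \<longrightarrow> block F \<Delta> i j \<in> graded_hom R (F i) (F j))"
proof -
  interpret D: differential R D \<delta>
    using assms(2) by (simp add: differential_module_iff)
  interpret homology_resolution R D \<delta> F d e
  proof (intro homology_resolution.intro D.differential_axioms graded_family.intro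
      D.graded_ring_axioms graded_family_axioms.intro homology_resolution_axioms.intro)
    show "graded_module R (F i)" "graded_free R (F i)" for i
      using assms(4) by (simp_all add: minimal_free_resolution_def graded_free_def)
  qed (use assms(4) in \<open>simp_all add: minimal_free_resolution_def\<close>)
  show ?thesis
    using exists_free_flag_resolution by blast
qed

end
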